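(* Suppose $\lim_{n\to\infty}h_{n-1}/h_n=1$ and let $k\ge2$. Let $r_n^{(k)}$ (resp. $R_n^{(k)}$) be the minimum (resp. maximum) range among all $k$-cycles of $\sigma_n$, where the range of a cycle is the difference between its maximum and minimum elements; if $\sigma_n$ has no $k$-cycles, set $r_n^{(k)}=n$ and $R_n^{(k)}=0$. Then $\frac{r_n^{(k)}}{n}\xrightarrow{d}r^{(k)}$ and $\frac{R_n^{(k)}}{n}\xrightarrow{d}R^{(k)}$ as $n\to\infty$, where $r^{(k)}$ and $R^{(k)}$ have cumulative distribution functions given for $x\in[0,1)$ by $$\mathbb P\{r^{(k)}\le x\}=1-\exp\Bigl\{-\frac{\theta_k}{k}\bigl(kx^{k-1}-(k-1)x^k\bigr)\Bigr\},$$ $$\mathbb P\{R^{(k)}\le x\}=\exp\Bigl\{\frac{\theta_k}{k}\bigl(kx^{k-1}-(k-1)x^k-1\bigr)\Bigr\},$$ and both cumulative distribution functions equal $0$ for $x<0$ and $1$ for $x\ge1$.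
   Context: Weighted permutations: let $\theta_k\ge 0$, $k\ge1$. For $\pi$ in the symmetric group $\mathcal S_n$ (permutations of $\{1,\ldots,n\}$) let $C_k(\pi)$ be the number of $k$-cycles of $\pi$. The random permutation $\sigma_n$ has distribution $\mathbb P\{\sigma_n=\pi\}=\frac{1}{h_n n!}\prod_{k=1}^\infty\theta_k^{C_k(\pi)}$, $\pi\in\mathcal S_n$, where $h_n=\frac1{n!}\sum_{\pi\in\mathcal S_n}\prod_{k=1}^\infty\theta_k^{C_k(\pi)}$ is the normalization (the condition $h_{n-1}/h_n\to1$ presupposes $h_n>0$ for all large $n$, which are the $n$ considered). $\xrightarrow{d}$ is convergence in distribution. *)

theory Defs
  imports "HOL-Probability.Probability" "HOL-Combinatorics.Orbits"
begin

text \<open>A cycle of a permutation of \<open>{1..n}\<close> is represented by the set of its elements, which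
  determines it. Note that \<^const>\<open>cyclic_on\<close> counts the singleton of a fixed point as a cycle.\<close>

definition cycles_of_length :: "nat \<Rightarrow> nat \<Rightarrow> (nat \<Rightarrow> nat) \<Rightarrow> nat set set" where
  "cycles_of_length n k \<pi> = {S. S \<subseteq> {1..n} \<and> cyclic_on \<pi> S \<and> card S = k}"

definition cycle_count :: "nat \<Rightarrow> nat \<Rightarrow> (nat \<Rightarrow> nat) \<Rightarrow> nat" where
  "cycle_count n k \<pi> = card (cycles_of_length n k \<pi>)"

text \<open>The product runs over all cycle lengths \<open>k \<ge> 1\<close>; the value \<open>\<theta> 0\<close> plays no role.\<close>

definition perm_weight :: "(nat \<Rightarrow> real) \<Rightarrow> nat \<Rightarrow> (nat \<Rightarrow> nat) \<Rightarrow> real" where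
  "perm_weight \<theta> n \<pi> = (\<Prod>k. \<theta> (Suc k) ^ cycle_count n (Suc k) \<pi>)"

definition perm_norm :: "(nat \<Rightarrow> real) \<Rightarrow> nat \<Rightarrow> real" where
  "perm_norm \<theta> n = (\<Sum>\<pi> | \<pi> permutes {1..n}. perm_weight \<theta> n \<pi>) / fact n"

definition is_weighted_random_perm ::
    "(nat \<Rightarrow> real) \<Rightarrow> nat \<Rightarrow> 'a measure \<Rightarrow> ('a \<Rightarrow> nat \<Rightarrow> nat) \<Rightarrow> bool" where
  "is_weighted_random_perm \<theta> n M \<sigma> \<longleftrightarrow>
     prob_space M \<and>
     \<sigma> \<in> measurable M (count_space {\<pi>. \<pi> permutes {1..n}}) \<and>
     (\<forall>\<pi>. \<pi> permutes {1..n} \<longrightarrow>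
        measure M {\<omega> \<in> space M. \<sigma> \<omega> = \<pi>} = perm_weight \<theta> n \<pi> / (perm_norm \<theta> n * fact n))"

definition cycle_range :: "nat set \<Rightarrow> nat" where
  "cycle_range S = Max S - Min S"

definition min_cycle_range :: "nat \<Rightarrow> nat \<Rightarrow> (nat \<Rightarrow> nat) \<Rightarrow> nat" where
  "min_cycle_range n k \<pi> =
     (if cycles_of_length n k \<pi> = {} then n else Min (cycle_range ` cycles_of_length n k \<pi>))"

definition max_cycle_range :: "nat \<Rightarrow> nat \<Rightarrow> (nat \<Rightarrow> nat) \<Rightarrow> nat" where
  "max_cycle_range n k \<pi> =
     (if cycles_of_length n k \<pi> = {} then 0 else Max (cycle_range ` cycles_of_length n k \<pi>))"

definition min_range_cdf :: "(nat \<Rightarrow> real) \<Rightarrow> nat \<Rightarrow> real \<Rightarrow> real" where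
  "min_range_cdf \<theta> k x =
     (if x < 0 then 0
      else if x < 1 then
        1 - exp (- (\<theta> k / real k) * (real k * x ^ (k - 1) - (real k - 1) * x ^ k))
      else 1)"

definition max_range_cdf :: "(nat \<Rightarrow> real) \<Rightarrow> nat \<Rightarrow> real \<Rightarrow> real" where
  "max_range_cdf \<theta> k x =
     (if x < 0 then 0
      else if x < 1 then
        exp ((\<theta> k / real k) * (real k * x ^ (k - 1) - (real k - 1) * x ^ k - 1))
      else 1)"

lemma cycle_count_eq_0: "n < k \<Longrightarrow> cycle_count n k \<pi> = 0"
proof -
  assume "n < k"
  have "S \<notin> cycles_of_length n k \<pi>" for S
  proof
    assume "S \<in> cycles_of_length n k \<pi>"
    then have "S \<subseteq> {1..n}" and "card S = k"
      by (simp_all add: cycles_of_length_def)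
    then have "k \<le> n"
      using card_mono[of "{1..n}" S] by simp
    with \<open>n < k\<close> show False by simp
  qed
  then have "cycles_of_length n k \<pi> = {}" by blast
  then show ?thesis by (simp add: cycle_count_def)
qed

lemma perm_weight_finite: "perm_weight \<theta> n \<pi> = (\<Prod>k=1..n. \<theta> k ^ cycle_count n k \<pi>)"
proof -
  have "perm_weight \<theta> n \<pi> = (\<Prod>k<n. \<theta> (Suc k) ^ cycle_count n (Suc k) \<pi>)"
    unfolding perm_weight_def
  proof (rule prodinf_finite)
    show "\<theta> (Suc j) ^ cycle_count n (Suc j) \<pi> = 1" if "j \<notin> {..<n}" for j
    proof -
      have "cycle_count n (Suc j) \<pi> = 0"
        by (rule cycle_count_eq_0) (use that in simp)
      then show ?thesis by (simp only: power_0)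
    qed
  qed (rule finite_lessThan)
  also have "\<dots> = (\<Prod>k=1..n. \<theta> k ^ cycle_count n k \<pi>)"
    by (simp only: prod.atLeast1_atMost_eq One_nat_def)
  finally show ?thesis .
qed

end

theory Submission
  imports Defs
begin

text \<open>For a family \<open>\<A>\<close> of \<open>k\<close>-subsets of \<open>{1..n}\<close> of size asymptotic to \<open>q n\<^sup>k\<close>, let \<open>N\<close> be the number of
  cycles of the random permutation that belong to \<open>\<A>\<close>. Prescribing \<open>j\<close> disjoint \<open>k\<close>-sets as cycles
  leaves an arbitrary permutation of the complement, so the \<open>j\<close>-th binomial moment of \<open>N\<close> is
  \<open>((k - 1)! \<theta>\<^sub>k)\<^sup>j / j!\<close> times the number of disjoint ordered \<open>j\<close>-tuples in \<open>\<A>\<close>, which is asymptotic to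
  \<open>(q n\<^sup>k)\<^sup>j\<close>, times a ratio of normalizations that the hypothesis shows to be asymptotic to
  \<open>n\<close> to the power \<open>- j k\<close>. By the Bonferroni inequalities \<open>N = 0\<close> has
  limiting probability \<open>exp (- (k - 1)! \<theta>\<^sub>k q)\<close>. The minimum (maximum) range is governed by the
  family of \<open>k\<close>-sets of range at most (more than) \<open>x n\<close>.\<close>

section \<open>Removing a prescribed cycle\<close>

text \<open>The ground set is arbitrary, since deleting a cycle leaves a permutation of a set that
  need not be an initial segment.\<close>

definition cycles_in :: "'a set \<Rightarrow> ('a \<Rightarrow> 'a) \<Rightarrow> 'a set set" where
  "cycles_in A \<pi> = {S. S \<subseteq> A \<and> cyclic_on \<pi> S}"

definition cyclic_perms :: "'a set \<Rightarrow> ('a \<Rightarrow> 'a) set" where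
  "cyclic_perms S = {c. c permutes S \<and> cyclic_on c S}"

lemma finite_cycles_in: "finite A \<Longrightarrow> finite (cycles_in A \<pi>)"
  by (rule finite_subset[of _ "Pow A"]) (auto simp: cycles_in_def)

lemma cycles_in_empty: "cycles_in {} \<pi> = {}"
  by (auto simp: cycles_in_def cyclic_on_def)

lemma cyclic_on_comp_disjoint:
  assumes "c \<in> cyclic_perms S" "\<rho> permutes B" "S \<inter> B = {}"
  shows "cyclic_on (c \<circ> \<rho>) S"
proof -
  have "(c \<circ> \<rho>) s = c s" if "s \<in> S" for s
    using that assms(3) permutes_not_in[OF assms(2), of s] by (auto simp: disjoint_iff)
  then show ?thesis
    using assms(1) cyclic_cong[of S c "c \<circ> \<rho>"] by (simp add: cyclic_perms_def)
qed

text \<open>Two cycles that share a point are both its orbit, so a cycle of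
  \<open>c \<circ> \<rho>\<close> meeting \<open>S\<close> is \<open>S\<close> itself. Any other
  cycle lies in \<open>B\<close>, where \<open>c \<circ> \<rho>\<close> agrees with
  \<open>\<rho>\<close>.\<close>

lemma cycles_in_comp_disjoint:
  assumes "c \<in> cyclic_perms S" "\<rho> permutes B" "S \<inter> B = {}"
  shows "cycles_in (S \<union> B) (c \<circ> \<rho>) = insert S (cycles_in B \<rho>)"
proof -
  have S: "cyclic_on (c \<circ> \<rho>) S"
    using assms by (rule cyclic_on_comp_disjoint)
  have c: "c permutes S" using assms(1) by (simp add: cyclic_perms_def)
  have eq: "(c \<circ> \<rho>) t = \<rho> t" if "t \<in> B" for t
    using that assms(3) permutes_in_image[OF assms(2), of t] permutes_not_in[OF c, of "\<rho> t"]
    by auto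
  have B: "cyclic_on (c \<circ> \<rho>) T \<longleftrightarrow> cyclic_on \<rho> T" if "T \<subseteq> B" for T
    by (rule cyclic_cong) (use that eq in auto)
  have SB: "T = S \<or> T \<subseteq> B" if "T \<subseteq> S \<union> B" "cyclic_on (c \<circ> \<rho>) T" for T
  proof (cases "T \<inter> S = {}")
    case True then show ?thesis using that by auto
  next
    case False
    then obtain x where "x \<in> T" "x \<in> S" by auto
    then show ?thesis using S that(2) by (metis orbit_cyclic_eq3)
  qed
  show ?thesis
  proof (intro set_eqI iffI)
    fix T assume "T \<in> cycles_in (S \<union> B) (c \<circ> \<rho>)"
    then show "T \<in> insert S (cycles_in B \<rho>)"
      using SB[of T] B[of T] by (simp add: cycles_in_def) blast
  next
    fix T assume "T \<in> insert S (cycles_in B \<rho>)"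
    then show "T \<in> cycles_in (S \<union> B) (c \<circ> \<rho>)"
      using S B[of T] by (auto simp: cycles_in_def)
  qed
qed

text \<open>The inverse restricts a permutation to \<open>S\<close> and to \<open>A - S\<close>;
  since \<open>S\<close> is a cycle, both parts are invariant and both restrictions are
  permutations.\<close>

lemma bij_betw_comp_disjoint:
  assumes "finite A" "S \<subseteq> A"
  shows "bij_betw (\<lambda>(c, \<rho>). c \<circ> \<rho>) (cyclic_perms S \<times> {\<rho>. \<rho> permutes (A - S)})
           {\<pi>. \<pi> permutes A \<and> cyclic_on \<pi> S}"
proof (rule bij_betw_byWitness[where f' = "\<lambda>\<pi>. (perm_restrict \<pi> S, perm_restrict \<pi> (A - S))"])
  have restr: "perm_restrict (c \<circ> \<rho>) S = c" "perm_restrict (c \<circ> \<rho>) (A - S) = \<rho>"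
    if "c permutes S" "\<rho> permutes (A - S)" for c \<rho>
  proof -
    have "\<rho> x \<notin> S" if "x \<in> A - S" for x
      using that permutes_in_image[OF \<open>\<rho> permutes (A - S)\<close>, of x] by auto
    then show "perm_restrict (c \<circ> \<rho>) S = c" "perm_restrict (c \<circ> \<rho>) (A - S) = \<rho>"
      using that by (auto simp: perm_restrict_def fun_eq_iff permutes_not_in)
  qed
  show "\<forall>a\<in>cyclic_perms S \<times> {\<rho>. \<rho> permutes (A - S)}.
      (perm_restrict (case a of (c, \<rho>) \<Rightarrow> c \<circ> \<rho>) S, 
        perm_restrict (case a of (c, \<rho>) \<Rightarrow> c \<circ> \<rho>) (A - S)) = a"
    using restr by (auto simp: cyclic_perms_def)
  have perms: "perm_restrict \<pi> S permutes S" "perm_restrict \<pi> (A - S) permutes (A - S)"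
    if \<pi>: "\<pi> permutes A" "cyclic_on \<pi> S" for \<pi>
  proof -
    show "perm_restrict \<pi> (A - S) permutes (A - S)"
      using \<pi> by (rule perm_restrict_diff_cyclic)
    \<comment> \<open>The implication from left to right makes \<open>\<pi>\<close> map
      \<open>S\<close> onto itself: the preimage of a point of \<open>S\<close>, which exists by
      surjectivity, lies in \<open>S\<close>.\<close>
    have "\<pi> x \<in> S \<longleftrightarrow> x \<in> S" for x
      using \<pi> by (meson cyclic_on_f_in cyclic_on_inI)
    then have "\<pi> ` S = S"
      using permutes_surj[OF \<pi>(1)] by (auto simp: surj_def image_iff) metis
    then have "bij_betw \<pi> S S"
      using permutes_inj[OF \<pi>(1)] by (auto simp: bij_betw_def inj_on_def inj_def)
    then have "bij_betw (perm_restrict \<pi> S) S S"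
      by (subst bij_betw_cong[of _ _ \<pi>]) (auto simp: perm_restrict_def)
    then show "perm_restrict \<pi> S permutes S"
      by (auto intro: bij_imp_permutes simp: perm_restrict_def)
  qed
  show "\<forall>\<pi>\<in>{\<pi>. \<pi> permutes A \<and> cyclic_on \<pi> S}.
      (case (perm_restrict \<pi> S, perm_restrict \<pi> (A - S)) of (c, \<rho>) \<Rightarrow> c \<circ> \<rho>) = \<pi>"
  proof clarify
    fix \<pi> assume \<pi>: "\<pi> permutes A" "cyclic_on \<pi> S"
    have "perm_restrict \<pi> S \<circ> perm_restrict \<pi> (A - S) = perm_restrict \<pi> (S \<union> (A - S))"
      using perms[OF \<pi>] by (intro perm_restrict_union) auto
    also have "S \<union> (A - S) = A" using assms by auto
    finally show "perm_restrict \<pi> S \<circ> perm_restrict \<pi> (A - S) = \<pi>"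
      using perm_restrict_id[OF \<pi>(1)] by (simp only:)
  qed
  show "(\<lambda>(c, \<rho>). c \<circ> \<rho>) ` (cyclic_perms S \<times> {\<rho>. \<rho> permutes (A - S)})
      \<subseteq> {\<pi>. \<pi> permutes A \<and> cyclic_on \<pi> S}"
  proof clarify
    fix c \<rho> assume a: "c \<in> cyclic_perms S" "\<rho> permutes (A - S)"
    have "c permutes A" using a(1) assms by (auto simp: cyclic_perms_def intro: permutes_subset)
    moreover have "\<rho> permutes A" using a(2) by (rule permutes_subset) auto
    ultimately show "c \<circ> \<rho> permutes A \<and> cyclic_on (c \<circ> \<rho>) S"
      using a cyclic_on_comp_disjoint[of c S \<rho> "A - S"] by (auto intro: permutes_compose)
  qed
  show "(\<lambda>\<pi>. (perm_restrict \<pi> S, perm_restrict \<pi> (A - S))) ` {\<pi>. \<pi> permutes A \<and> cyclic_on \<pi> S}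
      \<subseteq> cyclic_perms S \<times> {\<rho>. \<rho> permutes (A - S)}"
    using perms by (auto simp: cyclic_perms_def cyclic_on_perm_restrict)
qed

text \<open>\<open>g\<close> sees only the set of cycles, to which \<open>c\<close> contributes
  nothing but \<open>S\<close>. So all choices of \<open>c\<close> in the bijection contribute the
  same sum, and their number comes out as a factor.\<close>

lemma sum_perms_fixed_cycle:
  fixes g :: "'a set set \<Rightarrow> 'b::comm_semiring_1"
  assumes "finite A" "S \<subseteq> A"
  shows "(\<Sum>\<pi> | \<pi> permutes A \<and> cyclic_on \<pi> S. g (cycles_in A \<pi>)) =
    of_nat (card (cyclic_perms S)) *
      (\<Sum>\<rho> | \<rho> permutes (A - S). g (insert S (cycles_in (A - S) \<rho>)))"
proof -
  have A: "S \<union> (A - S) = A" using assms by auto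
  have "(\<Sum>\<pi> | \<pi> permutes A \<and> cyclic_on \<pi> S. g (cycles_in A \<pi>)) =
     (\<Sum>(c, \<rho>)\<in>cyclic_perms S \<times> {\<rho>. \<rho> permutes (A - S)}. g (cycles_in A (c \<circ> \<rho>)))"
    by (subst sum.reindex_bij_betw[OF bij_betw_comp_disjoint[OF assms], symmetric])
       (simp add: case_prod_unfold)
  also have "\<dots> = (\<Sum>(c, \<rho>)\<in>cyclic_perms S \<times> {\<rho>. \<rho> permutes (A - S)}.
      g (insert S (cycles_in (A - S) \<rho>)))"
    using cycles_in_comp_disjoint[of _ S _ "A - S", unfolded A] by (intro sum.cong) auto
  finally show ?thesis by (simp flip: sum.cartesian_product)
qed

lemma sum_Pow_card:
  fixes f :: "nat \<Rightarrow> 'b::semiring_1"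
  assumes "finite X"
  shows "(\<Sum>T\<in>Pow X. f (card T)) = (\<Sum>j\<le>card X. of_nat (card X choose j) * f j)"
proof -
  have "(\<Sum>T\<in>Pow X. f (card T)) = (\<Sum>j\<le>card X. \<Sum>T | T \<in> Pow X \<and> card T = j. f (card T))"
    using assms by (intro sum.group[symmetric]) (auto intro: card_mono)
  also have "\<dots> = (\<Sum>j\<le>card X. of_nat (card X choose j) * f j)"
    using n_subsets[OF assms] by (intro sum.cong) auto
  finally show ?thesis .
qed

text \<open>Permutations are grouped by the orbit of \<open>x\<close>. The index \<open>T\<close> is
  this orbit without \<open>x\<close>, so it runs freely over the subsets of
  \<open>A - {x}\<close>.\<close>

lemma sum_perms_cycle_through:
  fixes g :: "'a set set \<Rightarrow> 'b::comm_semiring_1"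
  assumes "finite A" "x \<in> A"
  shows "(\<Sum>\<pi> | \<pi> permutes A. g (cycles_in A \<pi>)) =
    (\<Sum>T\<in>Pow (A - {x}). of_nat (card (cyclic_perms (insert x T))) *
      (\<Sum>\<rho> | \<rho> permutes (A - {x} - T). g (insert (insert x T) (cycles_in (A - {x} - T) \<rho>))))"
proof -
  have orb: "cyclic_on \<pi> (insert x (orbit \<pi> x - {x}))" "orbit \<pi> x \<subseteq> A" if "\<pi> permutes A" for \<pi>
  proof -
    have "x \<in> orbit \<pi> x"
      using that assms by (intro permutation_self_in_orbit) (auto simp: permutation_permutes)
    then show "cyclic_on \<pi> (insert x (orbit \<pi> x - {x}))"
      using cyclic_on_orbit[OF that assms(1), of x] by (simp add: insert_absorb)
    show "orbit \<pi> x \<subseteq> A" using that assms(2) by (rule permutes_orbit_subset)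
  qed
  have "(\<Sum>\<pi> | \<pi> permutes A. g (cycles_in A \<pi>)) =
    (\<Sum>T\<in>Pow (A - {x}). \<Sum>\<pi> | \<pi> \<in> {\<pi>. \<pi> permutes A} \<and> orbit \<pi> x - {x} = T. g (cycles_in A \<pi>))"
    using assms orb(2) by (intro sum.group[symmetric]) (auto simp: finite_permutations)
  also have "\<dots> = (\<Sum>T\<in>Pow (A - {x}).
      \<Sum>\<pi> | \<pi> permutes A \<and> cyclic_on \<pi> (insert x T). g (cycles_in A \<pi>))"
  proof (intro sum.cong refl)
    fix T assume T: "T \<in> Pow (A - {x})"
    have "orbit \<pi> x - {x} = T \<longleftrightarrow> cyclic_on \<pi> (insert x T)" if "\<pi> permutes A" for \<pi>
    proof
      assume "cyclic_on \<pi> (insert x T)"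
      then have "orbit \<pi> x = insert x T" by (rule orbit_cyclic_eq3) simp
      with T show "orbit \<pi> x - {x} = T" by auto
    qed (use orb(1)[OF that] in auto)
    then show "{\<pi> \<in> {\<pi>. \<pi> permutes A}. orbit \<pi> x - {x} = T} =
        {\<pi>. \<pi> permutes A \<and> cyclic_on \<pi> (insert x T)}"
      by auto
  qed
  also have "\<dots> = (\<Sum>T\<in>Pow (A - {x}). of_nat (card (cyclic_perms (insert x T))) *
      (\<Sum>\<rho> | \<rho> permutes (A - insert x T).
        g (insert (insert x T) (cycles_in (A - insert x T) \<rho>))))"
    using assms by (intro sum.cong refl sum_perms_fixed_cycle) auto
  finally show ?thesis by (simp only: Diff_insert2[symmetric])
qed

text \<open>Counting all permutations by their cycle through a fixed point expresses the factorial as a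
  sum over subsets in which, by induction, only the term of the full set is unknown.\<close>

lemma card_cyclic_perms:
  assumes "finite S" "S \<noteq> {}"
  shows "card (cyclic_perms S) = fact (card S - 1)"
  using assms
proof (induction "card S" arbitrary: S rule: less_induct)
  case less
  obtain x where x: "x \<in> S" using less.prems by auto
  define X where "X = S - {x}"
  have X: "finite X" "x \<notin> X" "S = insert x X" using less.prems x by (auto simp: X_def)
  define f :: "nat \<Rightarrow> nat" where "f j = fact j * fact (card X - j)" for j
  have f: "f j = card (cyclic_perms (insert x T)) * fact (card (X - T))"
    if "T \<subseteq> X" "T \<noteq> X" "j = card T" for T j
  proof -
    have T: "finite T" "x \<notin> T" using that X by (auto intro: finite_subset)
    have "card T < card X" using that X by (intro psubset_card_mono) auto
    then have "card (cyclic_perms (insert x T)) = fact (card (insert x T) - 1)"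
      using T X by (intro less.hyps) auto
    then show ?thesis using T that X by (simp add: f_def card_Diff_subset)
  qed
  have "fact (Suc (card X)) = (\<Sum>\<pi> | \<pi> permutes S. 1 :: nat)"
    using X card_permutations[OF refl less.prems(1)] by simp
  also have "\<dots> = (\<Sum>T\<in>Pow X. card (cyclic_perms (insert x T)) * fact (card (X - T)))"
    using sum_perms_cycle_through[of S x "\<lambda>_. 1 :: nat"] less.prems x X
    by (simp add: X_def[symmetric] card_permutations)
  also have "\<dots> = card (cyclic_perms S) + (\<Sum>T\<in>Pow X - {X}. f (card T))"
  proof -
    have "(\<Sum>T\<in>Pow X - {X}. card (cyclic_perms (insert x T)) * fact (card (X - T))) =
        (\<Sum>T\<in>Pow X - {X}. f (card T))"
      by (intro sum.cong refl f[symmetric]) auto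
    then show ?thesis
      using X by (subst sum.remove[of _ X]) simp_all
  qed
  finally have eq: "fact (Suc (card X)) = card (cyclic_perms S) + (\<Sum>T\<in>Pow X - {X}. f (card T))" .
  \<comment> \<open>Here \<open>f (card X)\<close> is the claimed value, put in the place of the
    unknown term. Each cardinality contributes \<open>fact (card X)\<close>, so the sum is the same
    factorial as in \<open>eq\<close>, and comparison isolates the unknown.\<close>
  have "f (card X) + (\<Sum>T\<in>Pow X - {X}. f (card T)) = (\<Sum>T\<in>Pow X. f (card T))"
    using X by (subst sum.remove[of "Pow X" X]) auto
  also have "\<dots> = (\<Sum>j\<le>card X. (card X choose j) * f j)"
    using sum_Pow_card[OF X(1), of f] by simp
  also have "\<dots> = (\<Sum>j\<le>card X. fact (card X))"
    using binomial_fact_lemma[of _ "card X"] by (intro sum.cong) (auto simp: f_def mult_ac)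
  also have "\<dots> = fact (Suc (card X))" by simp
  finally show ?case using eq X by (simp add: f_def)
qed

section \<open>Total weights of finite sets\<close>

definition cycle_weight :: "(nat \<Rightarrow> real) \<Rightarrow> 'a set set \<Rightarrow> real" where
  "cycle_weight \<theta> C = (\<Prod>S\<in>C. \<theta> (card S))"

text \<open>For \<open>A = {1..n}\<close> this is
  \<open>fact n * perm_norm \<theta> n\<close>.\<close>

definition total_weight :: "(nat \<Rightarrow> real) \<Rightarrow> 'a set \<Rightarrow> real" where
  "total_weight \<theta> A = (\<Sum>\<pi> | \<pi> permutes A. cycle_weight \<theta> (cycles_in A \<pi>))"

lemma cycle_weight_insert:
  assumes "finite B" "S \<inter> B = {}" "S \<noteq> {}"
  shows "cycle_weight \<theta> (insert S (cycles_in B \<rho>)) = \<theta> (card S) * cycle_weight \<theta> (cycles_in B \<rho>)"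
  unfolding cycle_weight_def using assms
  by (subst prod.insert) (auto simp: finite_cycles_in cycles_in_def)

text \<open>The cycle through \<open>x\<close> has the form \<open>insert x T\<close>: it can be
  arranged in \<open>fact (card T)\<close> ways, has weight \<open>\<theta> (Suc (card T))\<close>,
  and leaves an arbitrary permutation of the rest.\<close>

lemma total_weight_rec:
  assumes "finite A" "x \<in> A"
  shows "total_weight \<theta> A =
    (\<Sum>T\<in>Pow (A - {x}). fact (card T) * \<theta> (Suc (card T)) * total_weight \<theta> (A - {x} - T))"
  unfolding total_weight_def sum_perms_cycle_through[OF assms, of "cycle_weight \<theta>"]
proof (intro sum.cong refl)
  fix T assume T: "T \<in> Pow (A - {x})"
  then have "finite T" "x \<notin> T" using assms by (auto intro: finite_subset)
  then show "real (card (cyclic_perms (insert x T))) * (\<Sum>\<rho> | \<rho> permutes (A - {x} - T).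
       cycle_weight \<theta> (insert (insert x T) (cycles_in (A - {x} - T) \<rho>))) =
     fact (card T) * \<theta> (Suc (card T)) *
       (\<Sum>\<pi> | \<pi> permutes (A - {x} - T). cycle_weight \<theta> (cycles_in (A - {x} - T) \<pi>))"
    using assms by (simp add: cycle_weight_insert card_cyclic_perms flip: sum_distrib_left)
qed

text \<open>The recursion involves only sizes of subsets and weights of smaller sets. A bijection
  between \<open>A\<close> and \<open>B\<close> without one point each transports the subsets, so no
  permutation has to be conjugated.\<close>

lemma total_weight_cong_card:
  assumes "finite A" "finite B" "card A = card B"
  shows "total_weight \<theta> A = total_weight \<theta> B"
  using assms
proof (induction "card A" arbitrary: A B rule: less_induct)
  case less
  show ?case
  proof (cases "A = {}")
    case True
    then have "B = {}" using less.prems by simp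
    then show ?thesis using True \<open>B = {}\<close> by (simp add: total_weight_def cycles_in_empty cycle_weight_def)
  next
    case False
    then have "B \<noteq> {}" using less.prems by auto
    with False obtain x y where xy: "x \<in> A" "y \<in> B" by auto
    define X Y where "X = A - {x}" "Y = B - {y}"
    have XY: "finite X" "finite Y" "card X = card Y" "card X < card A"
      using less.prems xy card_Diff1_less[of A x] by (auto simp: X_Y_def)
    then obtain f where f: "bij_betw f X Y"
      by (meson bij_betw_iff_card)
    have bij: "bij_betw ((`) f) (Pow X) (Pow Y)" using f by (rule bij_betw_Pow)
    have "total_weight \<theta> A =
      (\<Sum>T\<in>Pow X. fact (card T) * \<theta> (Suc (card T)) * total_weight \<theta> (X - T))"
      unfolding X_Y_def using less.prems xy by (intro total_weight_rec) auto
    also have "\<dots> = (\<Sum>T\<in>Pow X. fact (card (f ` T)) * \<theta> (Suc (card (f ` T))) *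
        total_weight \<theta> (Y - f ` T))"
    proof (intro sum.cong refl)
      fix T assume T: "T \<in> Pow X"
      have "inj_on f T" using f T by (auto simp: bij_betw_def inj_on_def)
      then have cT: "card (f ` T) = card T" by (rule card_image)
      have fT: "f ` T \<subseteq> Y" using f T by (auto simp: bij_betw_def)
      have "total_weight \<theta> (X - T) = total_weight \<theta> (Y - f ` T)"
      proof (rule less.hyps)
        show "card (X - T) < card A"
          using XY card_mono[of X "X - T"] by auto
        show "card (X - T) = card (Y - f ` T)"
          using T XY fT cT by (simp add: card_Diff_subset finite_subset)
      qed (use XY in auto)
      then show "fact (card T) * \<theta> (Suc (card T)) * total_weight \<theta> (X - T) =
        fact (card (f ` T)) * \<theta> (Suc (card (f ` T))) * total_weight \<theta> (Y - f ` T)"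
        by (simp add: cT)
    qed
    also have "\<dots> = (\<Sum>T\<in>Pow Y. fact (card T) * \<theta> (Suc (card T)) * total_weight \<theta> (Y - T))"
      by (rule sum.reindex_bij_betw[OF bij])
    also have "\<dots> = total_weight \<theta> B"
      unfolding X_Y_def using less.prems xy by (intro total_weight_rec[symmetric]) auto
    finally show ?thesis .
  qed
qed

section \<open>Binomial moments of the number of cycles in a family\<close>

lemma perm_weight_eq_cycle_weight:
  "perm_weight \<theta> n \<pi> = cycle_weight \<theta> (cycles_in {1..n} \<pi>)"
proof -
  have "cycle_weight \<theta> (cycles_in {1..n} \<pi>) =
      (\<Prod>k=1..n. \<Prod>S | S \<in> cycles_in {1..n} \<pi> \<and> card S = k. \<theta> (card S))"
    unfolding cycle_weight_def
  proof (rule prod.group[symmetric])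
    show "card ` cycles_in {1..n} \<pi> \<subseteq> {1..n}"
    proof clarify
      fix S assume "S \<in> cycles_in {1..n} \<pi>"
      then have "S \<subseteq> {1..n}" "S \<noteq> {}" by (auto simp: cycles_in_def cyclic_on_def)
      then show "card S \<in> {1..n}"
        using card_mono[of "{1..n}" S] by (auto simp: Suc_le_eq card_gt_0_iff finite_subset)
    qed
  qed (auto simp: finite_cycles_in)
  also have "\<dots> = (\<Prod>k=1..n. \<theta> k ^ cycle_count n k \<pi>)"
    by (intro prod.cong refl)
       (simp add: cycle_count_def cycles_of_length_def cycles_in_def conj_assoc)
  finally show ?thesis by (simp add: perm_weight_finite)
qed

lemma perm_norm_eq_total_weight: "perm_norm \<theta> n = total_weight \<theta> {1..n} / fact n"
  by (simp add: perm_norm_def total_weight_def perm_weight_eq_cycle_weight)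

text \<open>Dividing by \<open>total_weight \<theta> B\<close> gives the expectation of
  \<open>N choose j\<close>, with \<open>N\<close> the number of cycles in
  \<open>\<A>\<close>.\<close>

definition cycle_moment :: "(nat \<Rightarrow> real) \<Rightarrow> 'a set set \<Rightarrow> nat \<Rightarrow> 'a set \<Rightarrow> real" where
  "cycle_moment \<theta> \<A> j B = (\<Sum>\<pi> | \<pi> permutes B.
     cycle_weight \<theta> (cycles_in B \<pi>) * real (card (cycles_in B \<pi> \<inter> \<A>) choose j))"

text \<open>The identity (j + 1) C(N, j + 1) = N C(N - 1, j) turns the moment into a sum over one
  distinguished cycle \<open>S\<close> in \<open>\<A>\<close> and \<open>j\<close> others.
  Exchanging the sums and removing \<open>S\<close> leaves the lower moment on
  \<open>B - S\<close>.\<close>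

lemma cycle_moment_Suc:
  assumes "finite B" "{} \<notin> \<A>"
  shows "real (Suc j) * cycle_moment \<theta> \<A> (Suc j) B =
    (\<Sum>S | S \<in> \<A> \<and> S \<subseteq> B. fact (card S - 1) * \<theta> (card S) * cycle_moment \<theta> \<A> j (B - S))"
proof -
  \<comment> \<open>The decrement accounts for the distinguished cycle: once \<open>S\<close> is
    removed, \<open>g\<close> becomes the summand of the \<open>j\<close>-th moment on
    \<open>B - S\<close>, up to the factor \<open>\<theta> (card S)\<close>.\<close>
  define g where "g C = cycle_weight \<theta> C * real ((card (C \<inter> \<A>) - 1) choose j)" for C
  have choose: "real (Suc j) * real (N choose Suc j) = real N * real ((N - 1) choose j)" for N
    by (cases N) (simp_all only: Suc_times_binomial_eq of_nat_mult[symmetric] diff_Suc_1,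
      simp_all)
  have "real (Suc j) * cycle_moment \<theta> \<A> (Suc j) B =
    (\<Sum>\<pi> | \<pi> permutes B. cycle_weight \<theta> (cycles_in B \<pi>) *
       (real (Suc j) * real (card (cycles_in B \<pi> \<inter> \<A>) choose Suc j)))"
    by (simp add: cycle_moment_def sum_distrib_left mult_ac)
  also have "\<dots> = (\<Sum>\<pi> | \<pi> permutes B. \<Sum>S | S \<in> {S \<in> \<A>. S \<subseteq> B} \<and> cyclic_on \<pi> S. g (cycles_in B \<pi>))"
  proof (intro sum.cong refl)
    fix \<pi>
    have "{S. S \<in> {S \<in> \<A>. S \<subseteq> B} \<and> cyclic_on \<pi> S} = cycles_in B \<pi> \<inter> \<A>"
      by (auto simp: cycles_in_def)
    then show "cycle_weight \<theta> (cycles_in B \<pi>) *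
        (real (Suc j) * real (card (cycles_in B \<pi> \<inter> \<A>) choose Suc j)) =
      (\<Sum>S | S \<in> {S \<in> \<A>. S \<subseteq> B} \<and> cyclic_on \<pi> S. g (cycles_in B \<pi>))"
      unfolding choose by (simp add: g_def)
  qed
  also have "\<dots> = (\<Sum>S\<in>{S \<in> \<A>. S \<subseteq> B}. \<Sum>\<pi> | \<pi> \<in> {\<pi>. \<pi> permutes B} \<and> cyclic_on \<pi> S. g (cycles_in B \<pi>))"
    using assms finite_subset[of "{S \<in> \<A>. S \<subseteq> B}" "Pow B"]
    by (intro sum.swap_restrict) (auto simp: finite_permutations)
  also have "\<dots> = (\<Sum>S | S \<in> \<A> \<and> S \<subseteq> B.
      fact (card S - 1) * \<theta> (card S) * cycle_moment \<theta> \<A> j (B - S))"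
  proof (intro sum.cong refl)
    fix S assume S: "S \<in> {S \<in> \<A>. S \<subseteq> B}"
    have ne: "S \<noteq> {}" "finite S" using S assms by (auto intro: finite_subset)
    have g: "g (insert S (cycles_in (B - S) \<rho>)) = \<theta> (card S) * (cycle_weight \<theta> (cycles_in (B - S) \<rho>) *
      real (card (cycles_in (B - S) \<rho> \<inter> \<A>) choose j))" for \<rho>
    proof -
      have "S \<notin> cycles_in (B - S) \<rho>" using ne by (auto simp: cycles_in_def)
      then show ?thesis using S assms ne
        by (simp add: g_def cycle_weight_insert finite_cycles_in)
    qed
    have "(\<Sum>\<pi> | \<pi> permutes B \<and> cyclic_on \<pi> S. g (cycles_in B \<pi>)) =
      fact (card S - 1) * \<theta> (card S) * cycle_moment \<theta> \<A> j (B - S)"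
      using S assms ne by (subst sum_perms_fixed_cycle)
        (auto simp: g card_cyclic_perms cycle_moment_def sum_distrib_left mult_ac)
    then show "(\<Sum>\<pi> | \<pi> \<in> {\<pi>. \<pi> permutes B} \<and> cyclic_on \<pi> S. g (cycles_in B \<pi>)) =
      fact (card S - 1) * \<theta> (card S) * cycle_moment \<theta> \<A> j (B - S)"
      by simp
  qed
  finally show ?thesis .
qed

text \<open>These are the ordered \<open>j\<close>-tuples of pairwise disjoint members of
  \<open>\<A>\<close> inside \<open>B\<close>, counted along the same recursion as the
  moments.\<close>

primrec disjoint_tuples :: "'a set set \<Rightarrow> nat \<Rightarrow> 'a set \<Rightarrow> nat" where
  "disjoint_tuples \<A> 0 B = 1"
| "disjoint_tuples \<A> (Suc j) B = (\<Sum>S | S \<in> \<A> \<and> S \<subseteq> B. disjoint_tuples \<A> j (B - S))"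

text \<open>Each removed cycle yields a factor \<open>fact (k - 1) * \<theta> k\<close>, the order
  of removal accounts for \<open>fact j\<close>, and \<open>card B - j * k\<close> points remain. If
  this difference is truncated, there are no disjoint \<open>j\<close>-tuples and both sides
  vanish.\<close>

lemma cycle_moment_eq:
  assumes "finite B" "\<And>S. S \<in> \<A> \<Longrightarrow> card S = k" "0 < k"
  shows "cycle_moment \<theta> \<A> j B = (fact (k - 1) * \<theta> k) ^ j / fact j *
     real (disjoint_tuples \<A> j B) * total_weight \<theta> {1..card B - j * k}"
  using assms(1)
proof (induction j arbitrary: B)
  case 0
  then have "total_weight \<theta> B = total_weight \<theta> {1..card B}"
    by (intro total_weight_cong_card) auto
  then show ?case by (simp add: cycle_moment_def total_weight_def)
next
  case (Suc j)
  define a where "a = fact (k - 1) * \<theta> k"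
  have "real (Suc j) * cycle_moment \<theta> \<A> (Suc j) B =
      (\<Sum>S | S \<in> \<A> \<and> S \<subseteq> B. fact (card S - 1) * \<theta> (card S) * cycle_moment \<theta> \<A> j (B - S))"
    using assms(2)[of "{}"] assms(3) Suc.prems by (intro cycle_moment_Suc) auto
  also have "\<dots> = (\<Sum>S | S \<in> \<A> \<and> S \<subseteq> B. a * (a ^ j / fact j *
     real (disjoint_tuples \<A> j (B - S)) * total_weight \<theta> {1..card B - Suc j * k}))"
  proof (intro sum.cong refl)
    fix S assume S: "S \<in> {S. S \<in> \<A> \<and> S \<subseteq> B}"
    then have "card (B - S) = card B - k"
      using Suc.prems assms(2) by (auto simp: card_Diff_subset finite_subset)
    then show "fact (card S - 1) * \<theta> (card S) * cycle_moment \<theta> \<A> j (B - S) = a * (a ^ j / fact j *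
     real (disjoint_tuples \<A> j (B - S)) * total_weight \<theta> {1..card B - Suc j * k})"
      using Suc S assms(2) by (simp add: a_def)
  qed
  also have "\<dots> = a ^ Suc j / fact j * real (disjoint_tuples \<A> (Suc j) B) *
      total_weight \<theta> {1..card B - Suc j * k}"
    by (simp add: sum_distrib_left sum_distrib_right mult_ac)
  finally show ?case
    unfolding a_def by (simp add: field_simps del: disjoint_tuples.simps of_nat_Suc)
qed

section \<open>Counting disjoint tuples\<close>

lemma binomial_le_power: "n choose r \<le> n ^ r"
  by (cases "r \<le> n") (auto simp: binomial_le_pow binomial_eq_0)

lemma card_subsets_containing_le:
  assumes "finite V" "x \<in> V"
  shows "card {S. S \<subseteq> V \<and> card S = k \<and> x \<in> S} \<le> card V ^ (k - 1)"
proof -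
  have "{S. S \<subseteq> V \<and> card S = k \<and> x \<in> S} \<subseteq> insert x ` {T. T \<subseteq> V \<and> card T = k - 1}"
  proof clarify
    fix S assume "S \<subseteq> V" "x \<in> S" "k = card S"
    then show "S \<in> insert x ` {T. T \<subseteq> V \<and> card T = card S - 1}"
      using assms by (intro image_eqI[of _ _ "S - {x}"]) (auto simp: finite_subset)
  qed
  then have "card {S. S \<subseteq> V \<and> card S = k \<and> x \<in> S} \<le> card {T. T \<subseteq> V \<and> card T = k - 1}"
    using assms by (intro surj_card_le) auto
  also have "\<dots> = card V choose (k - 1)" using assms by (intro n_subsets)
  also have "\<dots> \<le> card V ^ (k - 1)" by (rule binomial_le_power)
  finally show ?thesis .
qed

text \<open>A member of \<open>\<A>\<close> that is not inside \<open>B\<close> contains a point of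
  \<open>V - B\<close>, and each such point lies in at most \<open>card V ^ (k - 1)\<close>
  members.\<close>

lemma card_family_within_ge:
  assumes "finite V" "\<A> \<subseteq> {S. S \<subseteq> V \<and> card S = k}"
  shows "card \<A> - card (V - B) * card V ^ (k - 1) \<le> card {S \<in> \<A>. S \<subseteq> B}"
proof -
  have fin: "finite \<A>" using assms by (intro finite_subset[of \<A> "Pow V"]) auto
  have "\<A> \<subseteq> {S \<in> \<A>. S \<subseteq> B} \<union> (\<Union>x\<in>V - B. {S. S \<subseteq> V \<and> card S = k \<and> x \<in> S})"
    using assms(2) by auto
  then have "card \<A> \<le> card ({S \<in> \<A>. S \<subseteq> B} \<union> (\<Union>x\<in>V - B. {S. S \<subseteq> V \<and> card S = k \<and> x \<in> S}))"
    using assms fin by (intro card_mono) auto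
  also have "\<dots> \<le> card {S \<in> \<A>. S \<subseteq> B} + card (\<Union>x\<in>V - B. {S. S \<subseteq> V \<and> card S = k \<and> x \<in> S})"
    by (rule card_Un_le)
  also have "card (\<Union>x\<in>V - B. {S. S \<subseteq> V \<and> card S = k \<and> x \<in> S})
      \<le> (\<Sum>x\<in>V - B. card {S. S \<subseteq> V \<and> card S = k \<and> x \<in> S})"
    using assms by (intro card_UN_le) auto
  also have "\<dots> \<le> (\<Sum>x\<in>V - B. card V ^ (k - 1))"
    using assms by (intro sum_mono card_subsets_containing_le) auto
  finally show ?thesis by simp
qed

lemma disjoint_tuples_le:
  assumes "finite \<A>"
  shows "disjoint_tuples \<A> j B \<le> card \<A> ^ j"
proof (induction j arbitrary: B)
  case (Suc j)
  have "disjoint_tuples \<A> (Suc j) B \<le> (\<Sum>S | S \<in> \<A> \<and> S \<subseteq> B. card \<A> ^ j)"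
    unfolding disjoint_tuples.simps by (intro sum_mono Suc.IH)
  also have "\<dots> \<le> card \<A> * card \<A> ^ j"
    using assms by (auto intro: card_mono)
  finally show ?case by simp
qed simp

text \<open>Each chosen set forbids \<open>k\<close> more points, so at every stage at most
  \<open>card (V - B) + j * k\<close> points of \<open>V\<close> are forbidden. Keeping
  \<open>B\<close> general lets the induction absorb the set just chosen.\<close>

lemma disjoint_tuples_ge:
  assumes "finite V" "\<A> \<subseteq> {S. S \<subseteq> V \<and> card S = k}"
  shows "(card \<A> - (card (V - B) + j * k) * card V ^ (k - 1)) ^ j \<le> disjoint_tuples \<A> j B"
proof (induction j arbitrary: B)
  case (Suc j)
  \<comment> \<open>With \<open>Suc j\<close> in it, \<open>u\<close> bounds from below both the
    number of choices for \<open>S\<close> and the base of the power that the induction hypothesis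
    gives for \<open>B - S\<close>.\<close>
  define u where "u = card \<A> - (card (V - B) + Suc j * k) * card V ^ (k - 1)"
  have "u * u ^ j \<le> card {S \<in> \<A>. S \<subseteq> B} * u ^ j"
  proof (rule mult_right_mono)
    have "u \<le> card \<A> - card (V - B) * card V ^ (k - 1)"
      unfolding u_def by (intro diff_le_mono2 mult_right_mono) auto
    also have "\<dots> \<le> card {S \<in> \<A>. S \<subseteq> B}" using assms by (rule card_family_within_ge)
    finally show "u \<le> card {S \<in> \<A>. S \<subseteq> B}" .
  qed simp
  also have "\<dots> = (\<Sum>S | S \<in> \<A> \<and> S \<subseteq> B. u ^ j)" by simp
  also have "\<dots> \<le> (\<Sum>S | S \<in> \<A> \<and> S \<subseteq> B. disjoint_tuples \<A> j (B - S))"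
  proof (intro sum_mono)
    fix S assume S: "S \<in> {S. S \<in> \<A> \<and> S \<subseteq> B}"
    have "card (V - (B - S)) \<le> card ((V - B) \<union> S)"
      using assms S by (intro card_mono) (auto intro: finite_subset)
    also have "\<dots> \<le> card (V - B) + k"
      using card_Un_le[of "V - B" S] S assms(2) by auto
    finally have "u \<le> card \<A> - (card (V - (B - S)) + j * k) * card V ^ (k - 1)"
      unfolding u_def by (intro diff_le_mono2 mult_right_mono) auto
    then have "u ^ j \<le> (card \<A> - (card (V - (B - S)) + j * k) * card V ^ (k - 1)) ^ j"
      by (intro power_mono) auto
    also have "\<dots> \<le> disjoint_tuples \<A> j (B - S)" by (rule Suc.IH)
    finally show "u ^ j \<le> disjoint_tuples \<A> j (B - S)" .
  qed
  finally show ?case by (simp add: u_def)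
qed simp

text \<open>Both bounds are \<open>j\<close>-th powers of \<open>card (\<A> n)\<close>, up to an
  error \<open>j * k * n ^ (k - 1)\<close> in the base, which is negligible against
  \<open>n ^ k\<close>.\<close>

lemma disjoint_tuples_asymp:
  assumes "\<And>n. \<A> n \<subseteq> {S. S \<subseteq> {1..n} \<and> card S = k}" "0 < k"
    and lim: "(\<lambda>n. real (card (\<A> n)) / real n ^ k) \<longlonglongrightarrow> q"
  shows "(\<lambda>n. real (disjoint_tuples (\<A> n) j {1..n}) / real n ^ (j * k)) \<longlonglongrightarrow> q ^ j"
proof (rule tendsto_sandwich)
  let ?l = "\<lambda>n. (real (card (\<A> n)) / real n ^ k - real (j * k) * (1 / real n))"
  have q: "0 \<le> q" by (rule tendsto_lowerbound[OF lim]) auto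
  \<comment> \<open>The maximum with 0 mirrors the truncated subtraction in the lower bound; it does
    not affect the limit because \<open>q\<close> is nonnegative.\<close>
  have "(\<lambda>n. max 0 (?l n)) \<longlonglongrightarrow> max 0 (q - real (j * k) * 0)"
    by (intro tendsto_intros lim lim_1_over_n)
  then have "(\<lambda>n. max 0 (?l n) ^ j) \<longlonglongrightarrow> (max 0 (q - real (j * k) * 0)) ^ j"
    by (rule tendsto_power)
  then show "(\<lambda>n. max 0 (?l n) ^ j) \<longlonglongrightarrow> q ^ j" using q by simp
  show "(\<lambda>n. (real (card (\<A> n)) / real n ^ k) ^ j) \<longlonglongrightarrow> q ^ j"
    by (intro tendsto_power lim)
  have "finite (\<A> n)" for n
    using assms(1)[of n] by (intro finite_subset[of "\<A> n" "Pow {1..n}"]) auto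
  then have "real (disjoint_tuples (\<A> n) j {1..n}) \<le> real (card (\<A> n)) ^ j" for n
    using disjoint_tuples_le[of "\<A> n" j "{1..n}"] by (simp flip: of_nat_power)
  then show "\<forall>\<^sub>F n in sequentially. real (disjoint_tuples (\<A> n) j {1..n}) / real n ^ (j * k)
      \<le> (real (card (\<A> n)) / real n ^ k) ^ j"
    by (intro always_eventually allI)
       (simp add: power_divide mult.commute[of j] power_mult divide_right_mono)
  show "\<forall>\<^sub>F n in sequentially. max 0 (?l n) ^ j
      \<le> real (disjoint_tuples (\<A> n) j {1..n}) / real n ^ (j * k)"
    using eventually_gt_at_top[of 0]
  proof eventually_elim
    fix n :: nat assume n: "0 < n"
    define u where "u = card (\<A> n) - (j * k) * n ^ (k - 1)"
    have nk: "real n ^ k = real n * real n ^ (k - 1)"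
      using \<open>0 < k\<close> by (cases k) auto
    have "max 0 (?l n) = max 0 (real (card (\<A> n)) - real (j * k) * real n ^ (k - 1)) / real n ^ k"
      using n by (simp add: nk field_simps max_def)
    also have "max 0 (real (card (\<A> n)) - real (j * k) * real n ^ (k - 1)) = real u"
    proof -
      have "real (a - b) = max 0 (real a - real b)" for a b :: nat by linarith
      from this[of "card (\<A> n)" "j * k * n ^ (k - 1)"] show ?thesis by (simp add: u_def)
    qed
    finally have "max 0 (?l n) ^ j = real (u ^ j) / real n ^ (j * k)"
      by (simp add: power_divide mult.commute[of j] power_mult)
    moreover have "u ^ j \<le> disjoint_tuples (\<A> n) j {1..n}"
      using disjoint_tuples_ge[OF _ assms(1), of n "{1..n}" j] by (simp add: u_def)
    ultimately show "max 0 (?l n) ^ j \<le> real (disjoint_tuples (\<A> n) j {1..n}) / real n ^ (j * k)"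
      by (simp only: divide_right_mono of_nat_mono zero_le_power of_nat_0_le_iff)
  qed
qed

section \<open>Limiting probability of avoiding a family\<close>

text \<open>The case \<open>N = 0\<close> is kept apart: there the sum is 1, while the right-hand
  side vanishes for positive \<open>m\<close>.\<close>

lemma alternating_binomial_sum:
  assumes "0 < N"
  shows "(\<Sum>j\<le>m. (-1) ^ j * real (N choose j)) = (-1) ^ m * real ((N - 1) choose m)"
  using gbinomial_sum_lower_neg[of "real N" m] assms
  by (simp add: binomial_gbinomial of_nat_diff mult.commute)

lemma alternating_binomial_sum_0: "(\<Sum>j\<le>m. (-1) ^ j * real (0 choose j)) = 1"
proof -
  have "(\<Sum>j\<le>m. (-1) ^ j * real (0 choose j)) = (\<Sum>j\<le>m. if j = 0 then 1 else 0)"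
    by (intro sum.cong) (auto simp: binomial_eq_0)
  then show ?thesis by simp
qed

text \<open>For positive \<open>N\<close> the parity of the last index decides the sign of the
  partial sum; for \<open>N = 0\<close> the partial sum is exactly 1.\<close>

lemma bonferroni_even: "of_bool (N = 0) \<le> (\<Sum>j\<le>2 * m. (-1) ^ j * real (N choose j))"
  using alternating_binomial_sum[of N "2 * m"] alternating_binomial_sum_0[of "2 * m"]
  by (cases "N = 0") auto

lemma bonferroni_odd: "(\<Sum>j\<le>2 * m + 1. (-1) ^ j * real (N choose j)) \<le> of_bool (N = 0)"
  using alternating_binomial_sum[of N "2 * m + 1"] alternating_binomial_sum_0[of "2 * m + 1"]
  by (cases "N = 0") (simp_all del: sum.atMost_Suc)

text \<open>The truncation is fixed before \<open>n\<close> tends to infinity: a large odd index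
  bounds \<open>P\<close> from below near \<open>L\<close>, a large even one from above.\<close>

lemma tendsto_alternating_bounds:
  fixes P :: "nat \<Rightarrow> real"
  assumes T: "\<And>m. (\<lambda>n. T m n) \<longlonglongrightarrow> s m" and s: "s \<longlonglongrightarrow> L"
    and upper: "\<And>m. \<forall>\<^sub>F n in sequentially. P n \<le> T (2 * m) n"
    and lower: "\<And>m. \<forall>\<^sub>F n in sequentially. T (2 * m + 1) n \<le> P n"
  shows "P \<longlonglongrightarrow> L"
proof (rule order_tendstoI)
  fix a assume "a < L"
  then have "\<forall>\<^sub>F m in sequentially. a < s m" by (rule order_tendstoD(1)[OF s])
  then obtain M where "\<And>m. M \<le> m \<Longrightarrow> a < s m" by (auto simp: eventually_sequentially)
  then have "a < s (2 * M + 1)" by simp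
  then have "\<forall>\<^sub>F n in sequentially. a < T (2 * M + 1) n" by (rule order_tendstoD(1)[OF T])
  with lower[of M] show "\<forall>\<^sub>F n in sequentially. a < P n" by eventually_elim simp
next
  fix a assume "L < a"
  then have "\<forall>\<^sub>F m in sequentially. s m < a" by (rule order_tendstoD(2)[OF s])
  then obtain M where "\<And>m. M \<le> m \<Longrightarrow> s m < a" by (auto simp: eventually_sequentially)
  then have "s (2 * M) < a" by simp
  then have "\<forall>\<^sub>F n in sequentially. T (2 * M) n < a" by (rule order_tendstoD(2)[OF T])
  with upper[of M] show "\<forall>\<^sub>F n in sequentially. P n < a" by eventually_elim simp
qed

section \<open>Positivity and ratios of total weights\<close>

lemma cycle_weight_nonneg:
  assumes "\<And>j. 1 \<le> j \<Longrightarrow> 0 \<le> \<theta> j" "finite A"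
  shows "0 \<le> cycle_weight \<theta> (cycles_in A \<pi>)"
  unfolding cycle_weight_def
proof (rule prod_nonneg)
  fix S assume "S \<in> cycles_in A \<pi>"
  then have "finite S" "S \<noteq> {}"
    using assms(2) by (auto simp: cycles_in_def cyclic_on_def intro: finite_subset)
  then show "0 \<le> \<theta> (card S)" by (intro assms(1)) (simp add: Suc_le_eq card_gt_0_iff)
qed

lemma total_weight_nonneg:
  assumes "\<And>j. 1 \<le> j \<Longrightarrow> 0 \<le> \<theta> j" "finite A"
  shows "0 \<le> total_weight \<theta> A"
  unfolding total_weight_def using assms by (intro sum_nonneg cycle_weight_nonneg)

text \<open>A quotient with denominator 0 is 0, so a ratio close to 1 excludes a vanishing total
  weight.\<close>

lemma eventually_total_weight_pos:
  assumes "\<And>j. 1 \<le> j \<Longrightarrow> 0 \<le> \<theta> j"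
    and "(\<lambda>n. perm_norm \<theta> (n - 1) / perm_norm \<theta> n) \<longlonglongrightarrow> 1"
  shows "\<forall>\<^sub>F n in sequentially. 0 < total_weight \<theta> {1..n}"
proof -
  have "\<forall>\<^sub>F n in sequentially. 0 < perm_norm \<theta> (n - 1) / perm_norm \<theta> n"
    by (rule order_tendstoD(1)[OF assms(2)]) simp
  then show ?thesis
  proof eventually_elim
    fix n assume "0 < perm_norm \<theta> (n - 1) / perm_norm \<theta> n"
    then have "total_weight \<theta> {1..n} \<noteq> 0" by (auto simp: perm_norm_eq_total_weight)
    then show "0 < total_weight \<theta> {1..n}"
      using total_weight_nonneg[of \<theta> "{1..n}"] assms(1) by force
  qed
qed

text \<open>The quotient telescopes into \<open>i\<close> ratios of consecutive weights. By the
  factorials in \<open>perm_norm\<close>, the hypothesis says that \<open>n\<close> times such a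
  ratio tends to 1.\<close>

lemma total_weight_ratio:
  assumes "\<And>j. 1 \<le> j \<Longrightarrow> 0 \<le> \<theta> j"
    and "(\<lambda>n. perm_norm \<theta> (n - 1) / perm_norm \<theta> n) \<longlonglongrightarrow> 1"
  shows "(\<lambda>n. total_weight \<theta> {1..n - i} * real n ^ i / total_weight \<theta> {1..n}) \<longlonglongrightarrow> 1"
proof (induction i)
  case 0
  have pos: "\<forall>\<^sub>F n in sequentially. 0 < total_weight \<theta> {1..n}"
    using assms by (rule eventually_total_weight_pos)
  have "\<forall>\<^sub>F n in sequentially. total_weight \<theta> {1..n - 0} * real n ^ 0 / total_weight \<theta> {1..n} = 1"
    using pos by eventually_elim simp
  then show ?case by (rule tendsto_eventually)
next
  case (Suc i)
  define W where "W n = total_weight \<theta> {1..n}" for n :: nat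
  have pos: "\<forall>\<^sub>F n in sequentially. 0 < total_weight \<theta> {1..n}"
    using assms by (rule eventually_total_weight_pos)
  have shift: "filterlim (\<lambda>n. n - i) sequentially sequentially"
    by (rule filterlim_minus_const_nat_at_top)
  have "\<forall>\<^sub>F n in sequentially.
      perm_norm \<theta> (n - 1) / perm_norm \<theta> n = W (n - 1) * real n / W n"
    using eventually_gt_at_top[of 0]
  proof eventually_elim
    fix n :: nat assume "0 < n"
    then obtain p where "n = Suc p" by (cases n) auto
    then show "perm_norm \<theta> (n - 1) / perm_norm \<theta> n = W (n - 1) * real n / W n"
      by (simp add: perm_norm_eq_total_weight W_def)
  qed
  then have "(\<lambda>n. W (n - 1) * real n / W n) \<longlonglongrightarrow> 1"
    using assms(2) by (rule Lim_transform_eventually[rotated])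
  then have 1: "(\<lambda>n. W (n - i - 1) * real (n - i) / W (n - i)) \<longlonglongrightarrow> 1"
    using shift by (rule filterlim_compose)
  \<comment> \<open>The shifted ratio carries the factor \<open>n - i\<close> where \<open>n\<close>
    is wanted; the quotient \<open>n / (n - i)\<close> corrects this and tends to 1.\<close>
  have "(\<lambda>n. 1 - real i * (1 / real n)) \<longlonglongrightarrow> 1 - real i * 0"
    by (intro tendsto_intros lim_1_over_n)
  then have "(\<lambda>n. 1 / (1 - real i * (1 / real n))) \<longlonglongrightarrow> 1 / (1 - real i * 0)"
    by (intro tendsto_intros) auto
  then have 2: "(\<lambda>n. 1 / (1 - real i * (1 / real n))) \<longlonglongrightarrow> 1" by simp
  have 3: "(\<lambda>n. W (n - i) * real n ^ i / W n) \<longlonglongrightarrow> 1"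
    using Suc by (simp add: W_def)
  have "(\<lambda>n. W (n - i - 1) * real (n - i) / W (n - i) * (1 / (1 - real i * (1 / real n))) *
      (W (n - i) * real n ^ i / W n)) \<longlonglongrightarrow> 1 * 1 * 1"
    by (intro tendsto_mult 1 2 3)
  moreover have "\<forall>\<^sub>F n in sequentially.
     W (n - i - 1) * real (n - i) / W (n - i) * (1 / (1 - real i * (1 / real n))) *
      (W (n - i) * real n ^ i / W n) = W (n - Suc i) * real n ^ Suc i / W n"
    using eventually_gt_at_top[of i] eventually_compose_filterlim[OF pos shift]
  proof eventually_elim
    fix n assume n: "i < n" "0 < total_weight \<theta> {1..n - i}"
    have "1 / (1 - real i * (1 / real n)) = real n / real (n - i)"
      using n by (simp add: field_simps of_nat_diff)
    moreover have "real (n - i) \<noteq> 0" "W (n - i) \<noteq> 0" using n by (auto simp: W_def)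
    ultimately show "W (n - i - 1) * real (n - i) / W (n - i) * (1 / (1 - real i * (1 / real n))) *
      (W (n - i) * real n ^ i / W n) = W (n - Suc i) * real n ^ Suc i / W n"
      by (simp del: of_nat_diff)
  qed
  ultimately show ?case
    unfolding W_def[symmetric] by (simp add: Lim_transform_eventually)
qed

text \<open>In the closed form of the moment, \<open>n ^ (j * k)\<close> is divided out of the tuple
  count and multiplied into the weight ratio, so that both factors converge.\<close>

lemma cycle_moment_limit:
  assumes "\<And>j. 1 \<le> j \<Longrightarrow> 0 \<le> \<theta> j"
    and "(\<lambda>n. perm_norm \<theta> (n - 1) / perm_norm \<theta> n) \<longlonglongrightarrow> 1"
    and \<A>: "\<And>n. \<A> n \<subseteq> {S. S \<subseteq> {1..n} \<and> card S = k}" and "0 < k"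
    and lim: "(\<lambda>n. real (card (\<A> n)) / real n ^ k) \<longlonglongrightarrow> q"
  shows "(\<lambda>n. cycle_moment \<theta> (\<A> n) j {1..n} / total_weight \<theta> {1..n}) \<longlonglongrightarrow>
    (fact (k - 1) * \<theta> k * q) ^ j / fact j"
proof -
  define a where "a = fact (k - 1) * \<theta> k"
  have "(\<lambda>n. a ^ j / fact j * (real (disjoint_tuples (\<A> n) j {1..n}) / real n ^ (j * k)) *
      (total_weight \<theta> {1..n - j * k} * real n ^ (j * k) / total_weight \<theta> {1..n})) \<longlonglongrightarrow>
      a ^ j / fact j * q ^ j * 1"
    by (intro tendsto_intros disjoint_tuples_asymp \<A> \<open>0 < k\<close> lim total_weight_ratio assms(1,2))
  moreover have "\<forall>\<^sub>F n in sequentially.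
      a ^ j / fact j * (real (disjoint_tuples (\<A> n) j {1..n}) / real n ^ (j * k)) *
      (total_weight \<theta> {1..n - j * k} * real n ^ (j * k) / total_weight \<theta> {1..n}) =
      cycle_moment \<theta> (\<A> n) j {1..n} / total_weight \<theta> {1..n}"
    using eventually_gt_at_top[of 0]
  proof eventually_elim
    fix n :: nat assume "0 < n"
    have "card S = k" if "S \<in> \<A> n" for S using that \<A>[of n] by auto
    then have "cycle_moment \<theta> (\<A> n) j {1..n} = (fact (k - 1) * \<theta> k) ^ j / fact j *
       real (disjoint_tuples (\<A> n) j {1..n}) * total_weight \<theta> {1..card {1..n} - j * k}"
      using \<open>0 < k\<close> by (intro cycle_moment_eq) auto
    then show "a ^ j / fact j * (real (disjoint_tuples (\<A> n) j {1..n}) / real n ^ (j * k)) *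
      (total_weight \<theta> {1..n - j * k} * real n ^ (j * k) / total_weight \<theta> {1..n}) =
      cycle_moment \<theta> (\<A> n) j {1..n} / total_weight \<theta> {1..n}"
      using \<open>0 < n\<close> by (simp add: a_def)
  qed
  ultimately show ?thesis
    by (simp add: Lim_transform_eventually power_mult_distrib a_def)
qed

lemma avoid_cycles_limit:
  assumes nonneg: "\<And>j. 1 \<le> j \<Longrightarrow> 0 \<le> \<theta> j"
    and ratio: "(\<lambda>n. perm_norm \<theta> (n - 1) / perm_norm \<theta> n) \<longlonglongrightarrow> 1"
    and \<A>: "\<And>n. \<A> n \<subseteq> {S. S \<subseteq> {1..n} \<and> card S = k}" and "0 < k"
    and lim: "(\<lambda>n. real (card (\<A> n)) / real n ^ k) \<longlonglongrightarrow> q"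
  shows "(\<lambda>n. (\<Sum>\<pi> | \<pi> permutes {1..n} \<and> cycles_in {1..n} \<pi> \<inter> \<A> n = {}. perm_weight \<theta> n \<pi>) /
      total_weight \<theta> {1..n}) \<longlonglongrightarrow> exp (- (fact (k - 1) * \<theta> k * q))"
proof (rule tendsto_alternating_bounds)
  define c where "c = fact (k - 1) * \<theta> k * q"
  let ?T = "\<lambda>m n. \<Sum>j\<le>m. (-1) ^ j * (cycle_moment \<theta> (\<A> n) j {1..n} / total_weight \<theta> {1..n})"
  let ?s = "\<lambda>m. \<Sum>j\<le>m. (-1) ^ j * ((fact (k - 1) * \<theta> k * q) ^ j / fact j)"
  let ?N = "\<lambda>n \<pi>. card (cycles_in {1..n} \<pi> \<inter> \<A> n)"
  show "?T m \<longlonglongrightarrow> ?s m" for m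
    by (intro tendsto_sum tendsto_mult tendsto_const cycle_moment_limit assms)
  have "(\<lambda>j. (- c) ^ j /\<^sub>R fact j) sums exp (- c)" by (rule exp_converges)
  then have "(\<lambda>m. \<Sum>j\<le>m. (- c) ^ j /\<^sub>R fact j) \<longlonglongrightarrow> exp (- c)" by (simp add: sums_def_le)
  moreover have "(- c) ^ j /\<^sub>R fact j = (-1) ^ j * (c ^ j / fact j)" for j
    by (subst power_minus) (simp add: divide_inverse mult_ac)
  ultimately show "?s \<longlonglongrightarrow> exp (- (fact (k - 1) * \<theta> k * q))" by (simp add: c_def)
  \<comment> \<open>Exchanging the sums writes the truncated alternating sum as a weighted average
    over permutations, so that the Bonferroni inequalities apply to each \<open>\<pi>\<close>
    separately.\<close>
  have T: "?T m n = (\<Sum>\<pi> | \<pi> permutes {1..n}. perm_weight \<theta> n \<pi> *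
      (\<Sum>j\<le>m. (-1) ^ j * real (?N n \<pi> choose j))) / total_weight \<theta> {1..n}" for m n
    unfolding cycle_moment_def sum_divide_distrib sum_distrib_left perm_weight_eq_cycle_weight
    by (subst sum.swap) (simp add: mult_ac)
  have P: "(\<Sum>\<pi> | \<pi> permutes {1..n} \<and> cycles_in {1..n} \<pi> \<inter> \<A> n = {}. perm_weight \<theta> n \<pi>) =
     (\<Sum>\<pi> | \<pi> permutes {1..n}. perm_weight \<theta> n \<pi> * of_bool (?N n \<pi> = 0))" for n
  proof -
    have "?N n \<pi> = 0 \<longleftrightarrow> cycles_in {1..n} \<pi> \<inter> \<A> n = {}" for \<pi>
      by (simp add: finite_cycles_in)
    then show ?thesis
      by (simp add: of_bool_def sum.If_cases finite_permutations Int_def if_distrib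
          cong: if_cong)
  qed
  have w: "0 \<le> perm_weight \<theta> n \<pi>" for n \<pi>
    unfolding perm_weight_eq_cycle_weight by (intro cycle_weight_nonneg nonneg) auto
  show "\<forall>\<^sub>F n in sequentially. (\<Sum>\<pi> | \<pi> permutes {1..n} \<and> cycles_in {1..n} \<pi> \<inter> \<A> n = {}.
      perm_weight \<theta> n \<pi>) / total_weight \<theta> {1..n} \<le> ?T (2 * m) n" for m
    unfolding T P by (intro always_eventually allI divide_right_mono sum_mono mult_left_mono
        bonferroni_even w total_weight_nonneg nonneg) auto
  show "\<forall>\<^sub>F n in sequentially. ?T (2 * m + 1) n \<le> (\<Sum>\<pi> | \<pi> permutes {1..n} \<and>
      cycles_in {1..n} \<pi> \<inter> \<A> n = {}. perm_weight \<theta> n \<pi>) / total_weight \<theta> {1..n}" for m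
    unfolding T P by (intro always_eventually allI divide_right_mono sum_mono mult_left_mono
        bonferroni_odd w total_weight_nonneg nonneg) auto
qed

section \<open>Counting subsets of bounded range\<close>

text \<open>The maximum is \<open>Suc n\<close>, so the range is controlled by the minimum alone;
  \<open>m \<le> n\<close> keeps \<open>Suc n - m\<close> from being truncated.\<close>

lemma cycle_range_le_iff_insert:
  assumes "T \<subseteq> {1..n}" "m \<le> n"
  shows "cycle_range (insert (Suc n) T) \<le> m \<longleftrightarrow> T \<subseteq> {Suc n - m..n}"
proof -
  have T: "finite T" using assms by (auto intro: finite_subset)
  have "Max (insert (Suc n) T) = Suc n" using T assms by (intro Max_eqI) auto
  then have "cycle_range (insert (Suc n) T) \<le> m \<longleftrightarrow> Suc n - m \<le> Min (insert (Suc n) T)"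
    using assms by (auto simp: cycle_range_def)
  also have "\<dots> \<longleftrightarrow> T \<subseteq> {Suc n - m..n}" using T assms by auto
  finally show ?thesis .
qed

lemma cycle_range_less:
  assumes "S \<subseteq> {1..n}" "S \<noteq> {}"
  shows "cycle_range S < n"
proof -
  have "finite S" using assms by (auto intro: finite_subset)
  then have "Max S \<in> S" "Min S \<in> S" using assms by auto
  then have "Max S \<le> n" "1 \<le> Min S" "1 \<le> n" using assms by auto
  then show ?thesis by (simp add: cycle_range_def)
qed

text \<open>Induction on \<open>n\<close> from \<open>m\<close>, where every \<open>k\<close>-subset
  qualifies. Passing to \<open>Suc n\<close> adds the sets containing \<open>Suc n\<close>, whose
  other \<open>k - 1\<close> elements are chosen among the \<open>m\<close> numbers just below
  it.\<close>

lemma card_subsets_range_le: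
  assumes "m \<le> n" "0 < k"
  shows "card {S. S \<subseteq> {1..n} \<and> card S = k \<and> cycle_range S \<le> m} =
    (m choose k) + (n - m) * (m choose (k - 1))"
  using assms(1)
proof (induction n rule: dec_induct)
  case base
  have "cycle_range S \<le> m" if "S \<subseteq> {1..m}" "card S = k" for S
    using that cycle_range_less[of S m] \<open>0 < k\<close> by force
  then have "{S. S \<subseteq> {1..m} \<and> card S = k \<and> cycle_range S \<le> m} = {S. S \<subseteq> {1..m} \<and> card S = k}"
    by auto
  then show ?case by (simp add: n_subsets)
next
  case (step n)
  let ?F = "\<lambda>n. {S. S \<subseteq> {1..n} \<and> card S = k \<and> cycle_range S \<le> m}"
  let ?G = "{T. T \<subseteq> {Suc n - m..n} \<and> card T = k - 1}"
  have G: "T \<subseteq> {1..n}" "Suc n \<notin> T" "finite T" if "T \<in> ?G" for T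
  proof -
    have "{Suc n - m..n} \<subseteq> {1..n}" using step.hyps by auto
    then show "T \<subseteq> {1..n}" using that by blast
    then show "Suc n \<notin> T" "finite T" by (auto intro: finite_subset)
  qed
  have "?F (Suc n) = ?F n \<union> insert (Suc n) ` ?G"
  proof (intro set_eqI iffI)
    fix S assume S: "S \<in> ?F (Suc n)"
    show "S \<in> ?F n \<union> insert (Suc n) ` ?G"
    proof (cases "Suc n \<in> S")
      case False
      then have "S \<subseteq> {1..n}" using S by (auto simp: le_Suc_eq)
      then show ?thesis using S by simp
    next
      case True
      define T where "T = S - {Suc n}"
      have T: "S = insert (Suc n) T" "T \<subseteq> {1..n}" using True S by (auto simp: T_def le_Suc_eq)
      have "card T = k - 1" using S True by (simp add: T_def)
      moreover have "T \<subseteq> {Suc n - m..n}"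
        using cycle_range_le_iff_insert[OF T(2), of m] step.hyps S T(1) by simp
      ultimately show ?thesis using T(1) by auto
    qed
  next
    fix S assume "S \<in> ?F n \<union> insert (Suc n) ` ?G"
    then show "S \<in> ?F (Suc n)"
    proof
      assume "S \<in> insert (Suc n) ` ?G"
      then obtain T where T: "T \<in> ?G" "S = insert (Suc n) T" by auto
      have "card S = k" using T G[OF T(1)] \<open>0 < k\<close> by simp
      moreover have "cycle_range S \<le> m"
        using cycle_range_le_iff_insert[of T n m] T G[OF T(1)] step.hyps by simp
      moreover have "S \<subseteq> {1..Suc n}" using T G[OF T(1)] by auto
      ultimately show ?thesis by simp
    qed auto
  qed
  moreover have "card (?F n \<union> insert (Suc n) ` ?G) = card (?F n) + card (insert (Suc n) ` ?G)"
  proof (rule card_Un_disjoint)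
    show "finite (?F n)" by (rule finite_subset[of _ "Pow {1..n}"]) auto
    show "finite (insert (Suc n) ` ?G)" by simp
    show "?F n \<inter> insert (Suc n) ` ?G = {}" by auto
  qed
  moreover have "card (insert (Suc n) ` ?G) = card ?G"
    using G by (intro card_image inj_onI) (metis Diff_insert_absorb)
  moreover have "card ?G = m choose (k - 1)"
    using step.hyps by (simp add: n_subsets)
  moreover have "Suc n - m = Suc (n - m)" using step.hyps by simp
  ultimately show ?case using step.IH by simp
qed

section \<open>Limits of the subset counts\<close>

lemma binomial_div_power_limit:
  assumes "(\<lambda>n. real (m n) / real n) \<longlonglongrightarrow> x"
  shows "(\<lambda>n. real (m n choose k) / real n ^ k) \<longlonglongrightarrow> x ^ k / fact k"
proof -
  \<comment> \<open>As a falling product the coefficient has a fixed number \<open>k\<close> of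
    factors, each tending to \<open>x\<close> after division by \<open>n\<close>. This also covers
    \<open>m n < k\<close>, where a factor vanishes.\<close>
  have "(\<lambda>n. (\<Prod>i = 0..<k. real (m n) / real n - real i * (1 / real n)) / fact k) \<longlonglongrightarrow>
      (\<Prod>i = 0..<k. x - real i * 0) / fact k"
    by (intro tendsto_intros assms lim_1_over_n) auto
  moreover have "(\<Prod>i = 0..<k. real (m n) / real n - real i * (1 / real n)) / fact k =
      real (m n choose k) / real n ^ k" for n
  proof -
    have "(\<Prod>i = 0..<k. real (m n) / real n - real i * (1 / real n)) =
        (\<Prod>i = 0..<k. (real (m n) - real i) / real n)"
      by (simp add: diff_divide_distrib)
    also have "\<dots> = (\<Prod>i = 0..<k. real (m n) - real i) / real n ^ k"
      by (simp add: prod_dividef)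
    finally show ?thesis by (simp add: binomial_gbinomial gbinomial_prod_rev)
  qed
  ultimately show ?thesis by simp
qed

lemma nat_floor_div_limit:
  assumes "0 \<le> x"
  shows "(\<lambda>n. real (nat \<lfloor>x * real n\<rfloor>) / real n) \<longlonglongrightarrow> x"
proof (rule tendsto_sandwich)
  have "(\<lambda>n. x - 1 / real n) \<longlonglongrightarrow> x - 0" by (intro tendsto_intros lim_1_over_n)
  then show "(\<lambda>n. x - 1 / real n) \<longlonglongrightarrow> x" by simp
  show "\<forall>\<^sub>F n in sequentially. x - 1 / real n \<le> real (nat \<lfloor>x * real n\<rfloor>) / real n"
    using eventually_gt_at_top[of 0]
  proof eventually_elim
    fix n :: nat assume "0 < n"
    moreover have "x * real n - 1 \<le> real (nat \<lfloor>x * real n\<rfloor>)" by linarith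
    ultimately show "x - 1 / real n \<le> real (nat \<lfloor>x * real n\<rfloor>) / real n"
      by (simp add: pos_le_divide_eq left_diff_distrib)
  qed
  show "\<forall>\<^sub>F n in sequentially. real (nat \<lfloor>x * real n\<rfloor>) / real n \<le> x"
    using eventually_gt_at_top[of 0]
  proof eventually_elim
    fix n :: nat assume "0 < n"
    then show "real (nat \<lfloor>x * real n\<rfloor>) / real n \<le> x"
      using assms by (simp add: field_simps)
  qed
qed simp

lemma range_le_iff_nat_floor: "0 \<le> y \<Longrightarrow> real r \<le> y \<longleftrightarrow> r \<le> nat \<lfloor>y\<rfloor>"
  by linarith

text \<open>As ranges are integers, the threshold \<open>x * real n\<close> may be replaced by its
  integer part, which is at most \<open>n\<close> because \<open>x < 1\<close>; the exact count then
  applies.\<close>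

lemma card_subsets_range_le_limit:
  assumes "0 < k" "0 \<le> x" "x < 1"
  shows "(\<lambda>n. real (card {S. S \<subseteq> {1..n} \<and> card S = k \<and> real (cycle_range S) \<le> x * real n}) /
      real n ^ k) \<longlonglongrightarrow> x ^ k / fact k + (1 - x) * (x ^ (k - 1) / fact (k - 1))"
proof -
  define m where "m n = nat \<lfloor>x * real n\<rfloor>" for n
  have lim: "(\<lambda>n. real (m n) / real n) \<longlonglongrightarrow> x"
    unfolding m_def using assms(2) by (rule nat_floor_div_limit)
  have m: "m n \<le> n" for n
  proof -
    have "x * real n \<le> 1 * real n" using assms by (intro mult_right_mono) auto
    then show ?thesis unfolding m_def by linarith
  qed
  have "(\<lambda>n. real (m n choose k) / real n ^ k +
      (1 - real (m n) / real n) * (real (m n choose (k - 1)) / real n ^ (k - 1))) \<longlonglongrightarrow>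
      x ^ k / fact k + (1 - x) * (x ^ (k - 1) / fact (k - 1))"
    by (intro tendsto_intros binomial_div_power_limit lim)
  moreover have "\<forall>\<^sub>F n in sequentially. real (m n choose k) / real n ^ k +
      (1 - real (m n) / real n) * (real (m n choose (k - 1)) / real n ^ (k - 1)) =
      real (card {S. S \<subseteq> {1..n} \<and> card S = k \<and> real (cycle_range S) \<le> x * real n}) / real n ^ k"
    using eventually_gt_at_top[of 0]
  proof eventually_elim
    fix n :: nat assume n: "0 < n"
    have "real n ^ k = real n * real n ^ (k - 1)" using assms(1) by (cases k) auto
    moreover have "real (cycle_range S) \<le> x * real n \<longleftrightarrow> cycle_range S \<le> m n" for S
      unfolding m_def using assms by (intro range_le_iff_nat_floor) auto
    then have "card {S. S \<subseteq> {1..n} \<and> card S = k \<and> real (cycle_range S) \<le> x * real n} =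
        (m n choose k) + (n - m n) * (m n choose (k - 1))"
      by (simp only: card_subsets_range_le[OF m assms(1)])
    ultimately show "real (m n choose k) / real n ^ k +
      (1 - real (m n) / real n) * (real (m n choose (k - 1)) / real n ^ (k - 1)) =
      real (card {S. S \<subseteq> {1..n} \<and> card S = k \<and> real (cycle_range S) \<le> x * real n}) / real n ^ k"
      using n m[of n] by (simp add: of_nat_diff field_simps)
  qed
  ultimately show ?thesis by (rule Lim_transform_eventually)
qed

lemma card_subsets_range_gt_limit:
  assumes "0 < k" "0 \<le> x" "x < 1"
  shows "(\<lambda>n. real (card {S. S \<subseteq> {1..n} \<and> card S = k \<and> x * real n < real (cycle_range S)}) /
      real n ^ k) \<longlonglongrightarrow> 1 / fact k - (x ^ k / fact k + (1 - x) * (x ^ (k - 1) / fact (k - 1)))"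
proof -
  let ?le = "\<lambda>n. {S. S \<subseteq> {1..n} \<and> card S = k \<and> real (cycle_range S) \<le> x * real n}"
  let ?gt = "\<lambda>n. {S. S \<subseteq> {1..n} \<and> card S = k \<and> x * real n < real (cycle_range S)}"
  have split: "real (card (?gt n)) = real (n choose k) - real (card (?le n))" for n
  proof -
    have fin: "finite (?gt n)" "finite (?le n)"
      by (rule finite_subset[of _ "Pow {1..n}"]; auto)+
    have "card (?gt n \<union> ?le n) = card (?gt n) + card (?le n)"
      using fin by (intro card_Un_disjoint) auto
    moreover have "?gt n \<union> ?le n = {S. S \<subseteq> {1..n} \<and> card S = k}" by auto
    ultimately show ?thesis by (simp add: n_subsets)
  qed
  have "(\<lambda>n. real n / real n) \<longlonglongrightarrow> 1"
    by (rule tendsto_eventually) (use eventually_gt_at_top[of 0] in \<open>eventually_elim, simp\<close>)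
  from binomial_div_power_limit[OF this, of k]
  have "(\<lambda>n. real (n choose k) / real n ^ k) \<longlonglongrightarrow> 1 / fact k" by simp
  from tendsto_diff[OF this card_subsets_range_le_limit[OF assms]]
  show ?thesis unfolding split by (simp add: diff_divide_distrib)
qed

section \<open>Distribution of the extremal ranges\<close>

text \<open>The event is a finite disjoint union of events prescribing the value of
  \<open>\<sigma>\<close>; \<open>f\<close> is measurable as a function on a discrete space.\<close>

lemma cdf_weighted_random_perm:
  assumes "is_weighted_random_perm \<theta> n M \<sigma>"
  shows "cdf (distr M borel (\<lambda>\<omega>. f (\<sigma> \<omega>))) x =
    (\<Sum>\<pi> | \<pi> permutes {1..n} \<and> f \<pi> \<le> x. perm_weight \<theta> n \<pi>) / total_weight \<theta> {1..n}"
proof -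
  have M: "prob_space M" and \<sigma>: "\<sigma> \<in> measurable M (count_space {\<pi>. \<pi> permutes {1..n}})"
    and prob: "\<And>\<pi>. \<pi> permutes {1..n} \<Longrightarrow>
      measure M {\<omega> \<in> space M. \<sigma> \<omega> = \<pi>} = perm_weight \<theta> n \<pi> / total_weight \<theta> {1..n}"
    using assms by (auto simp: is_weighted_random_perm_def perm_norm_eq_total_weight)
  interpret prob_space M by (rule M)
  let ?X = "{\<pi>. \<pi> permutes {1..n} \<and> f \<pi> \<le> x}"
  have meas: "(\<lambda>\<omega>. f (\<sigma> \<omega>)) \<in> borel_measurable M"
    using \<sigma> by (rule measurable_compose) simp
  have in_perms: "\<sigma> \<omega> permutes {1..n}" if "\<omega> \<in> space M" for \<omega>
    using measurable_space[OF \<sigma> that] by simp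
  have "cdf (distr M borel (\<lambda>\<omega>. f (\<sigma> \<omega>))) x = measure M ((\<lambda>\<omega>. f (\<sigma> \<omega>)) -` {..x} \<inter> space M)"
    unfolding cdf_def using meas by (intro measure_distr) auto
  also have "(\<lambda>\<omega>. f (\<sigma> \<omega>)) -` {..x} \<inter> space M = (\<Union>\<pi>\<in>?X. {\<omega> \<in> space M. \<sigma> \<omega> = \<pi>})"
    using in_perms by auto
  also have "measure M \<dots> = (\<Sum>\<pi>\<in>?X. measure M {\<omega> \<in> space M. \<sigma> \<omega> = \<pi>})"
  proof (rule finite_measure_finite_Union)
    show "finite ?X" by (rule finite_subset[OF _ finite_permutations[of "{1..n}"]]) auto
    have "{\<omega> \<in> space M. \<sigma> \<omega> = \<pi>} \<in> sets M" if "\<pi> permutes {1..n}" for \<pi>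
      using measurable_sets[OF \<sigma>, of "{\<pi>}"] that by (simp add: vimage_def Int_def conj_commute)
    then show "(\<lambda>\<pi>. {\<omega> \<in> space M. \<sigma> \<omega> = \<pi>}) ` ?X \<subseteq> sets M" by auto
    show "disjoint_family_on (\<lambda>\<pi>. {\<omega> \<in> space M. \<sigma> \<omega> = \<pi>}) ?X"
      by (auto simp: disjoint_family_on_def)
  qed
  also have "\<dots> = (\<Sum>\<pi>\<in>?X. perm_weight \<theta> n \<pi> / total_weight \<theta> {1..n})"
    by (intro sum.cong refl prob) auto
  finally show ?thesis by (simp add: sum_divide_distrib)
qed

lemma sum_perm_weight: "(\<Sum>\<pi> | \<pi> permutes {1..n}. perm_weight \<theta> n \<pi>) = total_weight \<theta> {1..n}"
  by (simp add: total_weight_def perm_weight_eq_cycle_weight)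

lemma cycles_of_length_eq: "cycles_of_length n k \<pi> = {S \<in> cycles_in {1..n} \<pi>. card S = k}"
  by (auto simp: cycles_of_length_def cycles_in_def)

text \<open>If there is no \<open>k\<close>-cycle, the default value \<open>n\<close> gives the
  ratio 1, which exceeds \<open>x\<close> because \<open>x < 1\<close>.\<close>

lemma min_cycle_range_le_iff:
  assumes "0 < n" "x < 1"
  shows "real (min_cycle_range n k \<pi>) / real n \<le> x \<longleftrightarrow>
    cycles_in {1..n} \<pi> \<inter>
      {S. S \<subseteq> {1..n} \<and> card S = k \<and> real (cycle_range S) \<le> x * real n} \<noteq> {}"
proof (cases "cycles_of_length n k \<pi> = {}")
  case True
  then have "cycles_in {1..n} \<pi> \<inter>
      {S. S \<subseteq> {1..n} \<and> card S = k \<and> real (cycle_range S) \<le> x * real n} = {}"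
    by (auto simp: cycles_of_length_eq)
  then show ?thesis using True assms by (simp add: min_cycle_range_def)
next
  case False
  let ?R = "cycle_range ` cycles_of_length n k \<pi>"
  have fin: "finite ?R" by (simp add: cycles_of_length_eq finite_cycles_in)
  have "real (min_cycle_range n k \<pi>) / real n \<le> x \<longleftrightarrow> real (Min ?R) \<le> x * real n"
    using False assms(1) by (simp add: min_cycle_range_def field_simps)
  also have "\<dots> \<longleftrightarrow> (\<exists>S\<in>cycles_of_length n k \<pi>. real (cycle_range S) \<le> x * real n)"
  proof
    assume le: "real (Min ?R) \<le> x * real n"
    have "Min ?R \<in> ?R" using fin False by (intro Min_in) auto
    then obtain S where "S \<in> cycles_of_length n k \<pi>" "Min ?R = cycle_range S" by auto
    with le show "\<exists>S\<in>cycles_of_length n k \<pi>. real (cycle_range S) \<le> x * real n" by auto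
  next
    assume "\<exists>S\<in>cycles_of_length n k \<pi>. real (cycle_range S) \<le> x * real n"
    then obtain S where S: "S \<in> cycles_of_length n k \<pi>" "real (cycle_range S) \<le> x * real n"
      by auto
    then have "Min ?R \<le> cycle_range S" using fin by (intro Min_le) auto
    with S(2) show "real (Min ?R) \<le> x * real n" by linarith
  qed
  also have "\<dots> \<longleftrightarrow> cycles_in {1..n} \<pi> \<inter>
      {S. S \<subseteq> {1..n} \<and> card S = k \<and> real (cycle_range S) \<le> x * real n} \<noteq> {}"
    by (auto simp: cycles_of_length_eq cycles_in_def)
  finally show ?thesis .
qed

text \<open>If there is no \<open>k\<close>-cycle, the default value 0 gives the ratio 0, which is
  at most \<open>x\<close> because \<open>0 \<le> x\<close>.\<close>

lemma max_cycle_range_le_iff: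
  assumes "0 < n" "0 \<le> x"
  shows "real (max_cycle_range n k \<pi>) / real n \<le> x \<longleftrightarrow>
    cycles_in {1..n} \<pi> \<inter>
      {S. S \<subseteq> {1..n} \<and> card S = k \<and> x * real n < real (cycle_range S)} = {}"
proof (cases "cycles_of_length n k \<pi> = {}")
  case True
  then have "cycles_in {1..n} \<pi> \<inter>
      {S. S \<subseteq> {1..n} \<and> card S = k \<and> x * real n < real (cycle_range S)} = {}"
    by (auto simp: cycles_of_length_eq)
  then show ?thesis using True assms by (simp add: max_cycle_range_def)
next
  case False
  let ?R = "cycle_range ` cycles_of_length n k \<pi>"
  have fin: "finite ?R" by (simp add: cycles_of_length_eq finite_cycles_in)
  have "real (max_cycle_range n k \<pi>) / real n \<le> x \<longleftrightarrow> Max ?R \<le> nat \<lfloor>x * real n\<rfloor>"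
    using False assms by (simp add: max_cycle_range_def field_simps range_le_iff_nat_floor)
  also have "\<dots> \<longleftrightarrow> (\<forall>S\<in>cycles_of_length n k \<pi>. real (cycle_range S) \<le> x * real n)"
    using fin False assms by (subst Max_le_iff) (auto simp: range_le_iff_nat_floor)
  also have "\<dots> \<longleftrightarrow> cycles_in {1..n} \<pi> \<inter>
      {S. S \<subseteq> {1..n} \<and> card S = k \<and> x * real n < real (cycle_range S)} = {}"
    by (auto simp: cycles_of_length_eq cycles_in_def not_less)
  finally show ?thesis .
qed

lemma cycle_range_ratio_bounds:
  assumes "0 < n"
  shows "0 \<le> real (min_cycle_range n k \<pi>) / real n" "real (min_cycle_range n k \<pi>) / real n \<le> 1"
    "0 \<le> real (max_cycle_range n k \<pi>) / real n" "real (max_cycle_range n k \<pi>) / real n \<le> 1"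
proof -
  let ?R = "cycle_range ` cycles_of_length n k \<pi>"
  have fin: "finite ?R" by (simp add: cycles_of_length_eq finite_cycles_in)
  have "r \<le> n" if "r \<in> ?R" for r
  proof -
    from that obtain S where "r = cycle_range S" "S \<subseteq> {1..n}" "S \<noteq> {}"
      by (auto simp: cycles_of_length_def cyclic_on_alldef)
    then show ?thesis using cycle_range_less[of S n] by simp
  qed
  then have "min_cycle_range n k \<pi> \<le> n" "max_cycle_range n k \<pi> \<le> n"
    using Min_in[OF fin] Max_in[OF fin] by (auto simp: min_cycle_range_def max_cycle_range_def)
  then show "real (min_cycle_range n k \<pi>) / real n \<le> 1" "real (max_cycle_range n k \<pi>) / real n \<le> 1"
    using assms by simp_all
qed simp_all

text \<open>The limiting probability that a uniformly random \<open>k\<close>-subset of \<open>{1..n}\<close> has range at most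
  \<open>x n\<close>.\<close>

definition range_prob :: "nat \<Rightarrow> real \<Rightarrow> real" where
  "range_prob k x = real k * x ^ (k - 1) - (real k - 1) * x ^ k"

text \<open>The derivative \<open>k * (k - 1) * t ^ (k - 2) * (1 - t)\<close> is nonnegative on the
  unit interval.\<close>

lemma range_prob_mono:
  assumes "2 \<le> k" "0 \<le> x" "x \<le> y" "y \<le> 1"
  shows "range_prob k x \<le> range_prob k y"
proof (rule DERIV_nonneg_imp_nondecreasing[OF assms(3)])
  fix t assume t: "x \<le> t" "t \<le> y"
  obtain l where l: "k = Suc (Suc l)" using assms(1) that[of "k - 2"] by simp
  have "(range_prob k has_real_derivative
      real k * (real (k - 1) * t ^ (k - 1 - 1)) - (real k - 1) * (real k * t ^ (k - 1))) (at t)"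
    unfolding range_prob_def by (auto intro!: derivative_eq_intros)
  moreover have "real k * (real (k - 1) * t ^ (k - 1 - 1)) - (real k - 1) * (real k * t ^ (k - 1)) =
      real k * (real k - 1) * t ^ l * (1 - t)"
    by (simp add: l algebra_simps)
  moreover have "0 \<le> real k * (real k - 1) * t ^ l * (1 - t)"
    using t assms by (intro mult_nonneg_nonneg) auto
  ultimately show "\<exists>D. (range_prob k has_real_derivative D) (at t) \<and> 0 \<le> D" by auto
qed

text \<open>For \<open>k = 1\<close> the value would be 1: a fixed point has range 0.\<close>

lemma range_prob_0: "2 \<le> k \<Longrightarrow> range_prob k 0 = 0"
  by (simp add: range_prob_def power_0_left)

lemma range_prob_1: "range_prob k 1 = 1"
  by (simp add: range_prob_def)

lemma continuous_range_prob: "continuous (at a within A) (range_prob k)"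
  unfolding range_prob_def[abs_def] by (intro continuous_intros)

text \<open>This brings the exponent found by counting into the form of the stated distribution
  functions; the factor \<open>1 / k\<close> is \<open>fact (k - 1) / fact k\<close>.\<close>

lemma range_prob_asymp:
  assumes "0 < k"
  shows "fact (k - 1) * t * (x ^ k / fact k + (1 - x) * (x ^ (k - 1) / fact (k - 1))) =
    t / real k * range_prob k x"
proof -
  obtain l where l: "k = Suc l" using assms by (cases k) auto
  show ?thesis by (simp add: l range_prob_def field_simps del: of_nat_Suc)
qed

section \<open>Piecewise distribution functions\<close>

lemma continuous_at_right_piecewise:
  fixes g :: "real \<Rightarrow> real"
  assumes "\<And>a. continuous (at_right a) g"
  shows "continuous (at_right a) (\<lambda>x. if x < 0 then 0 else if x < 1 then g x else 1)"
proof -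
  let ?f = "\<lambda>x. if x < 0 then 0 else if x < 1 then g x else 1"
  have ev: "\<forall>\<^sub>F x in at_right a. x < b" if "a < b" for b :: real
    using that by (auto simp: eventually_at_right)
  have gt: "\<forall>\<^sub>F x in at_right a. a < x" by (simp add: eventually_at_right_less)
  consider "a < 0" | "0 \<le> a" "a < 1" | "1 \<le> a" by linarith
  then show ?thesis
  proof cases
    case 1
    have "\<forall>\<^sub>F x in at_right a. ?f x = ?f a" using ev[OF 1] by eventually_elim (use 1 in auto)
    then show ?thesis unfolding continuous_within by (rule tendsto_eventually)
  next
    case 2
    have "\<forall>\<^sub>F x in at_right a. g x = ?f x" using ev[OF 2(2)] gt by eventually_elim (use 2 in auto)
    then have "(?f \<longlongrightarrow> g a) (at_right a)"
      using assms[of a] unfolding continuous_within by (rule Lim_transform_eventually[rotated])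
    then show ?thesis unfolding continuous_within using 2 by simp
  next
    case 3
    have "\<forall>\<^sub>F x in at_right a. ?f x = ?f a" using gt by eventually_elim (use 3 in auto)
    then show ?thesis unfolding continuous_within by (rule tendsto_eventually)
  qed
qed

text \<open>Only right continuity is asked for, so jumps at 0 and 1 are allowed. The limit laws have
  them: the limiting probability \<open>exp (- \<theta> k / k)\<close> of having no
  \<open>k\<close>-cycle is an atom at 1 for the minimum and at 0 for the maximum.\<close>

lemma real_distribution_piecewise:
  fixes F g :: "real \<Rightarrow> real"
  assumes F: "F = (\<lambda>x. if x < 0 then 0 else if x < 1 then g x else 1)"
    and cont: "\<And>a. continuous (at_right a) g"
    and mono: "\<And>x y. 0 \<le> x \<Longrightarrow> x \<le> y \<Longrightarrow> y < 1 \<Longrightarrow> g x \<le> g y"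
    and bounds: "\<And>x. 0 \<le> x \<Longrightarrow> x < 1 \<Longrightarrow> 0 \<le> g x \<and> g x \<le> 1"
  shows "real_distribution (interval_measure F) \<and> cdf (interval_measure F) = F"
proof -
  have F_mono: "F x \<le> F y" if "x \<le> y" for x y
    using that mono[of x y] bounds[of x] bounds[of y] by (auto simp: F)
  have F_cont: "continuous (at_right a) F" for a
    unfolding F by (rule continuous_at_right_piecewise[OF cont])
  have bot: "(F \<longlongrightarrow> 0) at_bot"
    by (rule tendsto_eventually) (use eventually_gt_at_bot in \<open>auto simp: F eventually_at_bot_dense\<close>)
  have top: "(F \<longlongrightarrow> 1) at_top"
    by (rule tendsto_eventually) (auto simp: F eventually_at_top_linorder intro!: exI[of _ 1])
  have "real_distribution (interval_measure F)"
    using F_mono F_cont bot top by (rule real_distribution_interval_measure)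
  moreover have "cdf (interval_measure F) = F"
    using F_mono F_cont bot by (rule cdf_interval_measure)
  ultimately show ?thesis by simp
qed

lemma min_range_cdf_eq:
  "min_range_cdf \<theta> k =
     (\<lambda>x. if x < 0 then 0 else if x < 1 then 1 - exp (- (\<theta> k / real k * range_prob k x)) else 1)"
  by (auto simp: min_range_cdf_def range_prob_def fun_eq_iff)

lemma max_range_cdf_eq:
  "max_range_cdf \<theta> k =
     (\<lambda>x. if x < 0 then 0 else if x < 1 then exp (\<theta> k / real k * (range_prob k x - 1)) else 1)"
  by (auto simp: max_range_cdf_def range_prob_def fun_eq_iff)

text \<open>The distribution functions are shown to converge at every point. Finitely many
  \<open>n\<close> may have \<open>perm_norm \<theta> n = 0\<close>; nothing is assumed about
  \<open>M n\<close> there, so formulas for the distributions are used for large \<open>n\<close>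
  only.\<close>

theorem proposition5:
  fixes \<theta> :: "nat \<Rightarrow> real" and k :: nat
    and M :: "nat \<Rightarrow> 'a measure" and \<sigma> :: "nat \<Rightarrow> 'a \<Rightarrow> nat \<Rightarrow> nat"
  assumes theta_nonneg: "\<And>j. 1 \<le> j \<Longrightarrow> 0 \<le> \<theta> j"
    and random_perm: "\<And>n. 0 < perm_norm \<theta> n \<Longrightarrow> is_weighted_random_perm \<theta> n (M n) (\<sigma> n)"
    and ratio: "(\<lambda>n. perm_norm \<theta> (n - 1) / perm_norm \<theta> n) \<longlonglongrightarrow> 1"
    and k: "2 \<le> k"
  shows "\<exists>\<mu>\<^sub>r \<mu>\<^sub>R. real_distribution \<mu>\<^sub>r \<and> real_distribution \<mu>\<^sub>R \<and>
      (\<forall>x. cdf \<mu>\<^sub>r x = min_range_cdf \<theta> k x) \<and>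
      (\<forall>x. cdf \<mu>\<^sub>R x = max_range_cdf \<theta> k x) \<and>
      weak_conv_m
        (\<lambda>n. distr (M n) borel (\<lambda>\<omega>. real (min_cycle_range n k (\<sigma> n \<omega>)) / real n)) \<mu>\<^sub>r \<and>
      weak_conv_m
        (\<lambda>n. distr (M n) borel (\<lambda>\<omega>. real (max_cycle_range n k (\<sigma> n \<omega>)) / real n)) \<mu>\<^sub>R"
proof -
  let ?c = "\<theta> k / real k"
  let ?W = "\<lambda>n::nat. total_weight \<theta> {1..n}"
  have c: "0 \<le> ?c" using theta_nonneg[of k] k by simp
  have p: "0 \<le> range_prob k x" "range_prob k x \<le> 1" if "0 \<le> x" "x < 1" for x
    using range_prob_mono[OF k, of 0 x] range_prob_mono[OF k, of x 1] that
    by (simp_all add: range_prob_0[OF k] range_prob_1)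
  have distr_r: "real_distribution (interval_measure (min_range_cdf \<theta> k)) \<and>
      cdf (interval_measure (min_range_cdf \<theta> k)) = min_range_cdf \<theta> k"
    using min_range_cdf_eq
  proof (rule real_distribution_piecewise)
    show "continuous (at_right a) (\<lambda>x. 1 - exp (- (?c * range_prob k x)))" for a
      by (intro continuous_intros continuous_range_prob)
    show "1 - exp (- (?c * range_prob k x)) \<le> 1 - exp (- (?c * range_prob k y))"
      if "0 \<le> x" "x \<le> y" "y < 1" for x y
      using mult_left_mono[OF range_prob_mono[OF k, of x y] c] that by simp
    show "0 \<le> 1 - exp (- (?c * range_prob k x)) \<and> 1 - exp (- (?c * range_prob k x)) \<le> 1"
      if "0 \<le> x" "x < 1" for x
      using mult_nonneg_nonneg[OF c p(1)[OF that]] by simp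
  qed
  have distr_R: "real_distribution (interval_measure (max_range_cdf \<theta> k)) \<and>
      cdf (interval_measure (max_range_cdf \<theta> k)) = max_range_cdf \<theta> k"
    using max_range_cdf_eq
  proof (rule real_distribution_piecewise)
    show "continuous (at_right a) (\<lambda>x. exp (?c * (range_prob k x - 1)))" for a
      by (intro continuous_intros continuous_range_prob)
    show "exp (?c * (range_prob k x - 1)) \<le> exp (?c * (range_prob k y - 1))"
      if "0 \<le> x" "x \<le> y" "y < 1" for x y
      using mult_left_mono[OF _ c, of "range_prob k x - 1" "range_prob k y - 1"]
        range_prob_mono[OF k, of x y] that by simp
    show "0 \<le> exp (?c * (range_prob k x - 1)) \<and> exp (?c * (range_prob k x - 1)) \<le> 1"
      if "0 \<le> x" "x < 1" for x
      using mult_nonneg_nonpos[OF c, of "range_prob k x - 1"] p(2)[OF that] by simp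
  qed

  have ev: "\<forall>\<^sub>F n in sequentially. 0 < n \<and> 0 < ?W n"
    using theta_nonneg ratio
    by (intro eventually_conj eventually_gt_at_top eventually_total_weight_pos)
  have cdf: "cdf (distr (M n) borel (\<lambda>\<omega>. f (\<sigma> n \<omega>))) x =
      (\<Sum>\<pi> | \<pi> permutes {1..n} \<and> f \<pi> \<le> x. perm_weight \<theta> n \<pi>) / ?W n" if "0 < ?W n" for f n x
    by (rule cdf_weighted_random_perm, rule random_perm)
       (use that in \<open>simp add: perm_norm_eq_total_weight\<close>)
  \<comment> \<open>Outside \<open>[0, 1)\<close> the distribution functions are eventually constant
    in \<open>n\<close>, because the ratios lie in the unit interval.\<close>
  have trivial: "(\<lambda>n. cdf (distr (M n) borel (\<lambda>\<omega>. f n (\<sigma> n \<omega>))) x) \<longlonglongrightarrow> of_bool (1 \<le> x)"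
    if "\<And>n \<pi>. 0 < n \<Longrightarrow> 0 \<le> f n \<pi> \<and> f n \<pi> \<le> 1" "x < 0 \<or> 1 \<le> x" for f and x :: real
  proof (rule tendsto_eventually, use ev in eventually_elim)
    fix n assume n: "0 < n \<and> 0 < ?W n"
    have "f n \<pi> \<le> x \<longleftrightarrow> 1 \<le> x" for \<pi> using that(1)[of n \<pi>] that(2) n by auto
    then show "cdf (distr (M n) borel (\<lambda>\<omega>. f n (\<sigma> n \<omega>))) x = of_bool (1 \<le> x)"
      using n by (simp add: cdf sum_perm_weight del: One_nat_def)
  qed

  have conv_r: "(\<lambda>n. cdf (distr (M n) borel (\<lambda>\<omega>. real (min_cycle_range n k (\<sigma> n \<omega>)) / real n)) x)
      \<longlonglongrightarrow> min_range_cdf \<theta> k x" for x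
  proof (cases "0 \<le> x \<and> x < 1")
    case False
    then show ?thesis
      using trivial[of "\<lambda>n \<pi>. real (min_cycle_range n k \<pi>) / real n" x] cycle_range_ratio_bounds
      by (auto simp: min_range_cdf_def)
  next
    case True
    let ?A = "\<lambda>n. {S. S \<subseteq> {1..n} \<and> card S = k \<and> real (cycle_range S) \<le> x * real n}"
    let ?P = "\<lambda>n. (\<Sum>\<pi> | \<pi> permutes {1..n} \<and> cycles_in {1..n} \<pi> \<inter> ?A n = {}. perm_weight \<theta> n \<pi>) / ?W n"
    have "?P \<longlonglongrightarrow> exp (- (fact (k - 1) * \<theta> k *
        (x ^ k / fact k + (1 - x) * (x ^ (k - 1) / fact (k - 1)))))"
      using k True theta_nonneg ratio by (intro avoid_cycles_limit card_subsets_range_le_limit) auto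
    then have "?P \<longlonglongrightarrow> exp (- (?c * range_prob k x))"
      using k by (subst (asm) range_prob_asymp) auto
    then have "(\<lambda>n. 1 - ?P n) \<longlonglongrightarrow> 1 - exp (- (?c * range_prob k x))"
      by (intro tendsto_intros)
    \<comment> \<open>The minimum is at most \<open>x * n\<close> exactly when some cycle lies in
      \<open>?A n\<close>, so this event is the complement of the avoidance event behind
      \<open>?P n\<close>.\<close>
    moreover have "\<forall>\<^sub>F n in sequentially. 1 - ?P n =
        cdf (distr (M n) borel (\<lambda>\<omega>. real (min_cycle_range n k (\<sigma> n \<omega>)) / real n)) x"
      using ev
    proof eventually_elim
      fix n assume n: "0 < n \<and> 0 < ?W n"
      let ?X = "{\<pi>. \<pi> permutes {1..n} \<and> cycles_in {1..n} \<pi> \<inter> ?A n = {}}"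
      have X: "{\<pi>. \<pi> permutes {1..n} \<and> cycles_in {1..n} \<pi> \<inter> ?A n \<noteq> {}} =
          {\<pi>. \<pi> permutes {1..n}} - ?X" by auto
      have "cdf (distr (M n) borel (\<lambda>\<omega>. real (min_cycle_range n k (\<sigma> n \<omega>)) / real n)) x =
        (\<Sum>\<pi> | \<pi> permutes {1..n} \<and> cycles_in {1..n} \<pi> \<inter> ?A n \<noteq> {}. perm_weight \<theta> n \<pi>) / ?W n"
        using n True cdf[of n "\<lambda>\<pi>. real (min_cycle_range n k \<pi>) / real n" x]
        by (simp only: min_cycle_range_le_iff)
      also have "\<dots> = (?W n - sum (perm_weight \<theta> n) ?X) / ?W n"
        unfolding X by (subst sum_diff) (auto simp: sum_perm_weight finite_permutations simp del: One_nat_def)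
      also have "\<dots> = 1 - ?P n" using n by (simp add: diff_divide_distrib)
      finally show "1 - ?P n =
        cdf (distr (M n) borel (\<lambda>\<omega>. real (min_cycle_range n k (\<sigma> n \<omega>)) / real n)) x" ..
    qed
    ultimately have "(\<lambda>n. cdf (distr (M n) borel
        (\<lambda>\<omega>. real (min_cycle_range n k (\<sigma> n \<omega>)) / real n)) x) \<longlonglongrightarrow> 1 - exp (- (?c * range_prob k x))"
      by (rule Lim_transform_eventually)
    then show ?thesis using True by (simp add: min_range_cdf_eq)
  qed

  have conv_R: "(\<lambda>n. cdf (distr (M n) borel (\<lambda>\<omega>. real (max_cycle_range n k (\<sigma> n \<omega>)) / real n)) x)
      \<longlonglongrightarrow> max_range_cdf \<theta> k x" for x
  proof (cases "0 \<le> x \<and> x < 1")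
    case False
    then show ?thesis
      using trivial[of "\<lambda>n \<pi>. real (max_cycle_range n k \<pi>) / real n" x] cycle_range_ratio_bounds
      by (auto simp: max_range_cdf_def)
  next
    case True
    \<comment> \<open>The maximum is at most \<open>x * n\<close> exactly when no
      \<open>k\<close>-cycle has larger range, so here the event is the avoidance event
      itself.\<close>
    let ?A = "\<lambda>n. {S. S \<subseteq> {1..n} \<and> card S = k \<and> x * real n < real (cycle_range S)}"
    let ?P = "\<lambda>n. (\<Sum>\<pi> | \<pi> permutes {1..n} \<and> cycles_in {1..n} \<pi> \<inter> ?A n = {}. perm_weight \<theta> n \<pi>) / ?W n"
    let ?q = "x ^ k / fact k + (1 - x) * (x ^ (k - 1) / fact (k - 1))"
    have "?P \<longlonglongrightarrow> exp (- (fact (k - 1) * \<theta> k * (1 / fact k - ?q)))"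
      using k True theta_nonneg ratio by (intro avoid_cycles_limit card_subsets_range_gt_limit) auto
    moreover have "fact (k - 1) * \<theta> k * (1 / fact k - ?q) = ?c * (1 - range_prob k x)"
    proof -
      have "fact (k - 1) * \<theta> k * (1 / fact k) = ?c"
        using k by (cases k) (auto simp: field_simps simp del: of_nat_Suc)
      then show ?thesis using k range_prob_asymp[of k "\<theta> k" x] by (simp add: right_diff_distrib)
    qed
    ultimately have "?P \<longlonglongrightarrow> exp (- (?c * (1 - range_prob k x)))" by (simp only:)
    then have "?P \<longlonglongrightarrow> exp (?c * (range_prob k x - 1))"
      by (simp only: mult_minus_right[symmetric] minus_diff_eq)
    moreover have "\<forall>\<^sub>F n in sequentially. ?P n =
        cdf (distr (M n) borel (\<lambda>\<omega>. real (max_cycle_range n k (\<sigma> n \<omega>)) / real n)) x"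
      using ev
    proof eventually_elim
      fix n assume "0 < n \<and> 0 < ?W n"
      then show "?P n = cdf (distr (M n) borel (\<lambda>\<omega>. real (max_cycle_range n k (\<sigma> n \<omega>)) / real n)) x"
        using True cdf[of n "\<lambda>\<pi>. real (max_cycle_range n k \<pi>) / real n" x]
        by (simp only: max_cycle_range_le_iff)
    qed
    ultimately have "(\<lambda>n. cdf (distr (M n) borel
        (\<lambda>\<omega>. real (max_cycle_range n k (\<sigma> n \<omega>)) / real n)) x) \<longlonglongrightarrow> exp (?c * (range_prob k x - 1))"
      by (rule Lim_transform_eventually)
    then show ?thesis using True by (simp add: max_range_cdf_eq)
  qed

  show ?thesis
    using distr_r distr_R conv_r conv_R
    by (intro exI[of _ "interval_measure (min_range_cdf \<theta> k)"]
        exI[of _ "interval_measure (max_range_cdf \<theta> k)"])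
       (simp add: weak_conv_m_def weak_conv_def)
qed

end
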